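(* Let $n\ge1$ be an integer and let $k$ be a positive integer. Then the vertex operator superalgebra $L_{osp(1|2n)}(k,0)$ is $C_2$-cofinite.
   Context: All spaces are over $\mathbb{C}$. $\mathfrak{g}=osp(1|2n)$ is the simple orthosymplectic Lie superalgebra with even part $\mathfrak{g}_{\bar0}\cong sp(2n)$. It is equipped with the nondegenerate even supersymmetric invariant bilinear form $(\cdot|\cdot)$ whose restriction to $\mathfrak{g}_{\bar0}$ is the normalized invariant form of $sp(2n)$ (long roots have square length $2$). Put $\hat{\mathfrak{g}}=\mathfrak{g}\otimes\mathbb{C}[t,t^{-1}]\oplus\mathbb{C}K$, $x(m)=x\otimes t^m$, $[x(m),y(l)]=[x,y](m+l)+(x|y)m\delta_{m+l,0}K$, $K$ central. $V^k(\mathfrak{g})=\mathrm{Ind}_{\mathfrak{g}\otimes\mathbb{C}[t]\oplus\mathbb{C}K}^{\hat{\mathfrak{g}}}\mathbb{C}\mathbf{1}$, where $\mathfrak{g}\otimes\mathbb{C}[t]$ acts on $\mathbf{1}$ by $0$ and $K$ by $k$; $L_{\mathfrak{g}}(k,0)$ is its unique irreducible quotient. It is a vertex operator superalgebra with vacuum $\mathbf{1}$, $Y(x(-1)\mathbf{1},z)=\sum_{m\in\mathbb{Z}}x(m)z^{-m-1}$ for $x\in\mathfrak{g}$, and conformal vector $\omega=\frac{1}{2(k+h^\vee)}\sum_ia^i(-1)b^i(-1)\mathbf{1}$, where $\{a^i\},\{b^i\}$ are dual bases of $\mathfrak{g}$ and $h^\vee$ is the dual Coxeter number of $(\mathfrak{g},(\cdot|\cdot))$.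 A vertex operator superalgebra $V$, with $Y(v,z)=\sum_{m\in\mathbb{Z}}v_mz^{-m-1}$, is $C_2$-cofinite if $\dim V/C_2(V)<\infty$, where $C_2(V)$ is the linear span of $\{u_{-2}v\mid u,v\in V\}$. *)

theory Defs
  imports "HOL-Analysis.Analysis" "HOL-Library.Poly_Mapping"
begin

section \<open>The Lie superalgebra $osp(1|2n)$\<close>

text \<open>
  The natural supermodule $\mathbb{C}^{1|2n}$ has its basis indexed by \<open>('n + 'n) option\<close> with
  \<open>n = CARD('n)\<close>: \<open>None\<close> is the even basis vector, the other \<open>2n\<close> basis vectors are odd.
  Throughout, the parity of a homogeneous element is a \<open>bool\<close> (\<open>True\<close> meaning odd), so that the sum
  of the parities \<open>p\<close>, \<open>q\<close> is \<open>p \<noteq> q\<close>.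
\<close>

type_synonym 'n gl = "complex ^ (('n + 'n) option) ^ (('n + 'n) option)"

definition odd_index :: "'n option \<Rightarrow> bool" where
  "odd_index i \<longleftrightarrow> i \<noteq> None"

definition parity_matrix :: "('n::finite) gl" where
  "parity_matrix = (\<chi> i j. if i = j then (if odd_index i then -1 else 1) else 0)"

definition even_mat :: "('n::finite) gl \<Rightarrow> 'n gl" where
  "even_mat A = (\<chi> i j. if odd_index i = odd_index j then A $ i $ j else 0)"

definition odd_mat :: "('n::finite) gl \<Rightarrow> 'n gl" where
  "odd_mat A = (\<chi> i j. if odd_index i = odd_index j then 0 else A $ i $ j)"

text \<open>Gram matrix of the even supersymmetric form on $\mathbb{C}^{1|2n}$: symmetric on the even
  line, symplectic on the odd part.\<close>

fun gram_entry :: "('n + 'n) option \<Rightarrow> ('n + 'n) option \<Rightarrow> complex" where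
  "gram_entry None None = 1"
| "gram_entry (Some (Inl a)) (Some (Inr b)) = (if a = b then 1 else 0)"
| "gram_entry (Some (Inr a)) (Some (Inl b)) = (if a = b then -1 else 0)"
| "gram_entry _ _ = 0"

definition gram :: "('n::finite) gl" where
  "gram = (\<chi> i j. gram_entry i j)"

text \<open>A homogeneous \<open>A\<close> of parity \<open>p\<close> preserves the form \<open>B\<close> if
  \<open>B (A v) w + (-1)\<^bsup>p |v|\<^esup> B v (A w) = 0\<close> for all homogeneous \<open>v\<close>, \<open>w\<close>; on basis vectors these are
  the two matrix equations below.\<close>

definition preserves_form :: "('n::finite) gl \<Rightarrow> bool" where
  "preserves_form A \<longleftrightarrow>
     transpose (even_mat A) ** gram + gram ** even_mat A = 0 \<and>
     transpose (odd_mat A) ** gram + parity_matrix ** gram ** odd_mat A = 0"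

text \<open>The supercommutator \<open>A B - (-1)\<^bsup>|A| |B|\<^esup> B A\<close>, extended bilinearly.\<close>

definition supercomm :: "('n::finite) gl \<Rightarrow> 'n gl \<Rightarrow> 'n gl" where
  "supercomm A B = A ** B - (even_mat B ** even_mat A + even_mat B ** odd_mat A
                             + odd_mat B ** even_mat A - odd_mat B ** odd_mat A)"

definition supertrace :: "('n::finite) gl \<Rightarrow> complex" where
  "supertrace A = (\<Sum>i\<in>UNIV. (if odd_index i then -1 else 1) * A $ i $ i)"

lemma even_mat_simps:
  "even_mat 0 = 0" "even_mat (A + B) = even_mat A + even_mat B"
  "even_mat (A - B) = even_mat A - even_mat B" "even_mat (- A) = - even_mat A"
  "even_mat (map_matrix ((*) c) A) = map_matrix ((*) c) (even_mat A)"
  "even_mat (even_mat A) = even_mat A" "even_mat (odd_mat A) = 0"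
  by (auto simp: even_mat_def odd_mat_def vec_eq_iff map_matrix_def)

lemma odd_mat_simps:
  "odd_mat 0 = 0" "odd_mat (A + B) = odd_mat A + odd_mat B"
  "odd_mat (A - B) = odd_mat A - odd_mat B" "odd_mat (- A) = - odd_mat A"
  "odd_mat (map_matrix ((*) c) A) = map_matrix ((*) c) (odd_mat A)"
  "odd_mat (odd_mat A) = odd_mat A" "odd_mat (even_mat A) = 0"
  by (auto simp: even_mat_def odd_mat_def vec_eq_iff map_matrix_def)

lemma even_mat_mult: "even_mat (A ** B) = even_mat A ** even_mat B + odd_mat A ** odd_mat B"
proof -
  have "even_mat (A ** B) $ i $ j =
    (\<Sum>k\<in>UNIV. even_mat A $ i $ k * even_mat B $ k $ j + odd_mat A $ i $ k * odd_mat B $ k $ j)" for i j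
    by (cases "odd_index i"; cases "odd_index j")
      (auto simp: even_mat_def odd_mat_def matrix_matrix_mult_def intro!: sum.cong sum.neutral)
  then show ?thesis
    by (simp add: vec_eq_iff matrix_matrix_mult_def sum.distrib)
qed

lemma odd_mat_mult: "odd_mat (A ** B) = even_mat A ** odd_mat B + odd_mat A ** even_mat B"
proof -
  have "odd_mat (A ** B) $ i $ j =
    (\<Sum>k\<in>UNIV. even_mat A $ i $ k * odd_mat B $ k $ j + odd_mat A $ i $ k * even_mat B $ k $ j)" for i j
    by (cases "odd_index i"; cases "odd_index j")
      (auto simp: even_mat_def odd_mat_def matrix_matrix_mult_def intro!: sum.cong sum.neutral)
  then show ?thesis
    by (simp add: vec_eq_iff matrix_matrix_mult_def sum.distrib)
qed

lemma even_plus_odd_mat: "even_mat A + odd_mat A = A"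
  by (auto simp: even_mat_def odd_mat_def vec_eq_iff)

lemma parity_matrix_mult_left:
  "(parity_matrix ** A) $ i $ j = (if odd_index i then -1 else 1) * A $ i $ j"
  by (simp add: parity_matrix_def matrix_matrix_mult_def if_distrib[where f = "\<lambda>x. x * _"]
      cong: if_cong)

lemma parity_matrix_mult_right:
  "(A ** parity_matrix) $ i $ j = (if odd_index j then -1 else 1) * A $ i $ j"
  by (simp add: parity_matrix_def matrix_matrix_mult_def if_distrib[where f = "\<lambda>x. _ * x"]
      cong: if_cong)

lemma parity_matrix_even_mat: "parity_matrix ** even_mat A = even_mat A ** parity_matrix"
  by (auto simp: vec_eq_iff parity_matrix_mult_left parity_matrix_mult_right even_mat_def)

lemma parity_matrix_odd_mat: "parity_matrix ** odd_mat A = - (odd_mat A ** parity_matrix)"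
  by (auto simp: vec_eq_iff parity_matrix_mult_left parity_matrix_mult_right odd_mat_def)

lemma gram_parity_matrix: "gram ** parity_matrix = parity_matrix ** (gram :: ('n::finite) gl)"
proof -
  have "odd_index i = odd_index j \<or> gram_entry i j = 0" for i j :: "('n + 'n) option"
    by (cases "(i, j)" rule: gram_entry.cases) (auto simp: odd_index_def)
  then show ?thesis
    by (simp add: vec_eq_iff parity_matrix_mult_left parity_matrix_mult_right gram_def) metis
qed

lemma parity_matrix_square: "parity_matrix ** parity_matrix = (mat 1 :: ('n::finite) gl)"
  by (auto simp: vec_eq_iff parity_matrix_mult_left mat_def) (auto simp: parity_matrix_def)

lemma transpose_parity_matrix: "transpose parity_matrix = (parity_matrix :: ('n::finite) gl)"
  by (auto simp: transpose_def vec_eq_iff parity_matrix_def)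

lemma matrix_uminus_left: "(- A) ** B = - (A ** B :: 'a::ring_1 ^ 'n::finite ^ 'm::finite)"
  by (simp add: vec_eq_iff matrix_matrix_mult_def sum_negf)

lemma matrix_uminus_right: "A ** (- B) = - (A ** B :: 'a::ring_1 ^ 'n::finite ^ 'm::finite)"
  by (simp add: vec_eq_iff matrix_matrix_mult_def sum_negf)

lemma transpose_arith:
  "transpose (A + B) = transpose A + transpose B"
  "transpose (A - B) = transpose A - transpose B"
  "transpose (- A) = - transpose A"
  "transpose 0 = 0"
  for A B :: "'a::ring_1 ^ 'n ^ 'm"
  by (simp_all add: transpose_def vec_eq_iff)

lemma matrix_minus_distrib:
  "A ** (B - C) = A ** B - A ** C" "(D - E) ** F = D ** F - E ** F"
  for A D E :: "'a::ring_1 ^ 'n::finite ^ 'm::finite"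
  by (simp_all add: vec_eq_iff matrix_matrix_mult_def left_diff_distrib right_diff_distrib
      sum_subtractf)

lemma matrix_add_distrib:
  "A ** (B + C) = A ** B + A ** C" "(D + E) ** F = D ** F + E ** F"
  for A D E :: "'a::ring_1 ^ 'n::finite ^ 'm::finite"
  by (simp_all add: vec_eq_iff matrix_matrix_mult_def distrib_left distrib_right sum.distrib)

lemma map_matrix_scale_mult:
  "map_matrix ((*) c) A ** B = map_matrix ((*) c) (A ** B)"
  "A ** map_matrix ((*) c) B = map_matrix ((*) c) (A ** B)"
  for A B :: "complex ^ 'n::finite ^ 'n"
  by (simp_all add: vec_eq_iff matrix_matrix_mult_def map_matrix_def sum_distrib_left mult_ac)

lemma preserves_form_0: "preserves_form 0"
  by (simp add: preserves_form_def even_mat_simps odd_mat_simps transpose_arith)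

lemma preserves_form_add:
  assumes "preserves_form (A :: ('n::finite) gl)" "preserves_form B" shows "preserves_form (A + B)"
proof -
  have *: "(a + b) + (c + d) = 0" if "a + c = 0" "b + d = 0" for a b c d :: "'n gl"
    using that by (simp add: add_eq_0_iff)
  show ?thesis
    using assms unfolding preserves_form_def even_mat_simps odd_mat_simps transpose_arith
      matrix_add_distrib by (auto intro: *)
qed

lemma preserves_form_scale:
  assumes "preserves_form (A :: ('n::finite) gl)" shows "preserves_form (map_matrix ((*) c) A)"
proof -
  have t: "transpose (map_matrix ((*) c) B) = map_matrix ((*) c) (transpose B)" for B :: "'n gl"
    by (simp add: transpose_def vec_eq_iff map_matrix_def)
  have *: "map_matrix ((*) c) a + map_matrix ((*) c) b = 0" if "a + b = 0" for a b :: "'n gl"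
    using that by (simp add: vec_eq_iff map_matrix_def add_eq_0_iff)
  show ?thesis
    using assms unfolding preserves_form_def even_mat_simps odd_mat_simps t map_matrix_scale_mult
    by (auto intro: *)
qed

lemma preserves_form_uminus:
  assumes "preserves_form (A :: ('n::finite) gl)" shows "preserves_form (- A)"
proof -
  have "map_matrix ((*) (-1)) A = - A"
    by (simp add: vec_eq_iff map_matrix_def)
  then show ?thesis using preserves_form_scale[OF assms, of "-1"] by simp
qed

lemma preserves_form_supercomm:
  assumes "preserves_form (A :: ('n::finite) gl)" "preserves_form B"
  shows "preserves_form (supercomm A B)"
proof -
  define P J :: "'n gl" where "P = parity_matrix" and "J = gram"
  define A0 A1 B0 B1 where "A0 = even_mat A" and "A1 = odd_mat A"
    and "B0 = even_mat B" and "B1 = odd_mat B"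
  note defs = A0_def A1_def B0_def B1_def
  have ev: "even_mat (supercomm A B) = A0 ** B0 + A1 ** B1 - B0 ** A0 + B1 ** A1"
    by (simp add: supercomm_def even_mat_simps odd_mat_simps even_mat_mult defs)
  have od: "odd_mat (supercomm A B) = (A0 ** B1 - B1 ** A0) + (A1 ** B0 - B0 ** A1)"
    by (simp add: supercomm_def even_mat_simps odd_mat_simps odd_mat_mult defs)
  have e0: "transpose X ** J = - (J ** X)"
    if "preserves_form C" "X = even_mat C" for C X
    using that unfolding preserves_form_def J_def by (simp add: eq_neg_iff_add_eq_0)
  have e1: "transpose X ** J = - (P ** J ** X)"
    if "preserves_form C" "X = odd_mat C" for C X
    using that unfolding preserves_form_def J_def P_def by (simp add: eq_neg_iff_add_eq_0)
  note A0 = e0[OF assms(1) A0_def] and A1 = e1[OF assms(1) A1_def]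
    and B0 = e0[OF assms(2) B0_def] and B1 = e1[OF assms(2) B1_def]
  have PJ: "J ** P = P ** J" and PP: "P ** P = mat 1"
    by (simp_all add: P_def J_def gram_parity_matrix parity_matrix_square)
  have P0: "transpose X ** P = P ** transpose X" if "X = even_mat C" for C X
    using arg_cong[OF parity_matrix_even_mat[of C], of transpose] that
    by (simp add: matrix_transpose_mul P_def transpose_parity_matrix)
  have P1: "P ** X = - (X ** P)" if "X = odd_mat C" for C X
    using parity_matrix_odd_mat[of C] that by (simp add: P_def)
  have P1t: "transpose X ** P = - (P ** transpose X)" if "X = odd_mat C" for C X
    using arg_cong[OF parity_matrix_odd_mat[of C], of transpose] that
    by (simp add: matrix_transpose_mul P_def transpose_parity_matrix transpose_arith)
  have ee: "transpose (X ** Y) ** J = J ** (Y ** X)"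
    if "transpose X ** J = - (J ** X)" "transpose Y ** J = - (J ** Y)" for X Y
  proof -
    have "transpose (X ** Y) ** J = transpose Y ** (transpose X ** J)"
      by (simp add: matrix_transpose_mul matrix_mul_assoc)
    also have "\<dots> = - ((transpose Y ** J) ** X)"
      by (simp add: that(1) matrix_uminus_right matrix_mul_assoc)
    also have "\<dots> = J ** (Y ** X)"
      by (simp add: that(2) matrix_uminus_left matrix_mul_assoc)
    finally show ?thesis .
  qed
  have oo: "transpose (X ** Y) ** J = - (J ** (Y ** X))"
    if "transpose X ** J = - (P ** J ** X)" "transpose Y ** J = - (P ** J ** Y)"
      "transpose Y ** P = - (P ** transpose Y)" for X Y
  proof -
    have "transpose (X ** Y) ** J = transpose Y ** (transpose X ** J)"
      by (simp add: matrix_transpose_mul matrix_mul_assoc)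
    also have "\<dots> = - ((transpose Y ** P) ** J ** X)"
      by (simp add: that(1) matrix_uminus_right matrix_mul_assoc)
    also have "\<dots> = P ** (transpose Y ** J) ** X"
      by (simp add: that(3) matrix_uminus_left matrix_mul_assoc)
    also have "\<dots> = - ((P ** P) ** J ** Y ** X)"
      by (simp only: that(2) matrix_uminus_left matrix_uminus_right matrix_mul_assoc)
    also have "\<dots> = - (J ** (Y ** X))"
      by (simp add: PP matrix_mul_assoc)
    finally show ?thesis .
  qed
  have eo: "transpose (X ** Y) ** J = P ** J ** (Y ** X)"
    if "transpose X ** J = - (J ** X)" "transpose Y ** J = - (P ** J ** Y)" for X Y
  proof -
    have "transpose (X ** Y) ** J = transpose Y ** (transpose X ** J)"
      by (simp add: matrix_transpose_mul matrix_mul_assoc)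
    also have "\<dots> = - ((transpose Y ** J) ** X)"
      by (simp add: that(1) matrix_uminus_right matrix_mul_assoc)
    also have "\<dots> = P ** J ** (Y ** X)"
      by (simp add: that(2) matrix_uminus_left matrix_mul_assoc)
    finally show ?thesis .
  qed
  have oe: "transpose (X ** Y) ** J = P ** J ** (Y ** X)"
    if "transpose X ** J = - (P ** J ** X)" "transpose Y ** J = - (J ** Y)"
      "transpose Y ** P = P ** transpose Y" for X Y
  proof -
    have "transpose (X ** Y) ** J = transpose Y ** (transpose X ** J)"
      by (simp add: matrix_transpose_mul matrix_mul_assoc)
    also have "\<dots> = - ((transpose Y ** P) ** J ** X)"
      by (simp add: that(1) matrix_uminus_right matrix_mul_assoc)
    also have "\<dots> = - (P ** (transpose Y ** J) ** X)"
      by (simp add: that(3) matrix_mul_assoc)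
    also have "\<dots> = P ** J ** (Y ** X)"
      by (simp only: that(2) matrix_uminus_left matrix_uminus_right matrix_mul_assoc minus_minus)
    finally show ?thesis .
  qed
  have 1: "transpose (even_mat (supercomm A B)) ** J + J ** even_mat (supercomm A B) = 0"
    unfolding ev transpose_arith matrix_add_distrib matrix_minus_distrib
      ee[OF A0 B0] ee[OF B0 A0] oo[OF A1 B1 P1t[OF B1_def]] oo[OF B1 A1 P1t[OF A1_def]]
    by simp
  have 2: "transpose (odd_mat (supercomm A B)) ** J + P ** J ** odd_mat (supercomm A B) = 0"
    unfolding od transpose_arith matrix_add_distrib matrix_minus_distrib
      eo[OF A0 B1] oe[OF B1 A0 P0[OF A0_def]] oe[OF A1 B0 P0[OF B0_def]] eo[OF B0 A1]
    by simp
  show ?thesis using 1 2 by (simp add: preserves_form_def P_def J_def)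
qed

typedef ('n::finite) osp = "{A :: 'n gl. preserves_form A}"
  using preserves_form_0 by blast

setup_lifting type_definition_osp

instantiation osp :: (finite) ab_group_add
begin

lift_definition zero_osp :: "'a osp" is 0 by (rule preserves_form_0)
lift_definition plus_osp :: "'a osp \<Rightarrow> 'a osp \<Rightarrow> 'a osp" is "(+)" by (rule preserves_form_add)
lift_definition uminus_osp :: "'a osp \<Rightarrow> 'a osp" is uminus by (rule preserves_form_uminus)
lift_definition minus_osp :: "'a osp \<Rightarrow> 'a osp \<Rightarrow> 'a osp" is "(-)"
  using preserves_form_add preserves_form_uminus by fastforce

instance by standard (transfer; simp add: algebra_simps)+

end

lift_definition osp_scale :: "complex \<Rightarrow> ('n::finite) osp \<Rightarrow> 'n osp" is "\<lambda>c. map_matrix ((*) c)"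
  by (rule preserves_form_scale)

lift_definition osp_bracket :: "('n::finite) osp \<Rightarrow> 'n osp \<Rightarrow> 'n osp" is supercomm
  by (rule preserves_form_supercomm)

interpretation osp: vector_space "osp_scale :: complex \<Rightarrow> ('n::finite) osp \<Rightarrow> 'n osp"
  by standard (transfer; simp add: vec_eq_iff map_matrix_def algebra_simps)+

text \<open>Homogeneous elements of parity \<open>p\<close>.\<close>

definition osp_part :: "bool \<Rightarrow> ('n::finite) osp set" where
  "osp_part p = {x. (if p then even_mat else odd_mat) (Rep_osp x) = 0}"

text \<open>With the sign chosen here, the restriction of the form to $sp(2n)$ is the trace form of the
  natural module $\mathbb{C}^{2n}$, which is the normalized form: for a long root the coroot is
  $E_{ii} - E_{n+i,n+i}$, of square length 2.\<close>

definition osp_form :: "('n::finite) osp \<Rightarrow> 'n osp \<Rightarrow> complex" where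
  "osp_form x y = - supertrace (Rep_osp x ** Rep_osp y)"

text \<open>The order of the arguments matters, as the form is skew on the odd part: it is
  $\sum_i a^i \otimes b^i$ with $(b^i|a^j) = \delta_{ij}$ that is invariant.\<close>

definition dual_bases :: "nat \<Rightarrow> (nat \<Rightarrow> ('n::finite) osp) \<Rightarrow> (nat \<Rightarrow> 'n osp) \<Rightarrow> bool" where
  "dual_bases d a b \<longleftrightarrow> osp.span (a ` {..<d}) = UNIV \<and>
     (\<forall>i<d. \<forall>j<d. osp_form (b i) (a j) = (if i = j then 1 else 0))"

text \<open>Half the eigenvalue of the Casimir element in the adjoint representation; in the present
  normalization it is $n + 1/2$.\<close>

definition dual_coxeter :: "('n::finite) itself \<Rightarrow> complex" where
  "dual_coxeter _ = (THE h. \<forall>d a b. dual_bases d a b \<longrightarrow>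
     (\<forall>x :: 'n osp. (\<Sum>i<d. osp_bracket (a i) (osp_bracket (b i) x)) = osp_scale (2 * h) x))"


section \<open>The affine Lie superalgebra\<close>

text \<open>The pair \<open>(f, c)\<close> stands for $\sum_m f_m \otimes t^m + c K$.\<close>

type_synonym 'n affine = "(int \<Rightarrow>\<^sub>0 'n osp) \<times> complex"

definition mode :: "('n::finite) osp \<Rightarrow> int \<Rightarrow> 'n affine" where
  "mode x m = (Poly_Mapping.single m x, 0)"

definition affine_scale :: "complex \<Rightarrow> ('n::finite) affine \<Rightarrow> 'n affine" where
  "affine_scale c x = (Poly_Mapping.map (osp_scale c) (fst x), c * snd x)"

definition affine_bracket :: "('n::finite) affine \<Rightarrow> 'n affine \<Rightarrow> 'n affine" where
  "affine_bracket x y =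
     (\<Sum>m\<in>Poly_Mapping.keys (fst x). \<Sum>l\<in>Poly_Mapping.keys (fst y).
        (let u = Poly_Mapping.lookup (fst x) m; v = Poly_Mapping.lookup (fst y) l
         in (Poly_Mapping.single (m + l) (osp_bracket u v),
             if m + l = 0 then of_int m * osp_form u v else 0)))"

definition affine_part :: "bool \<Rightarrow> ('n::finite) affine set" where
  "affine_part p = {x. (\<forall>m. Poly_Mapping.lookup (fst x) m \<in> osp_part p) \<and> (p \<longrightarrow> snd x = 0)}"

text \<open>The subalgebra $\mathfrak{g} \otimes \mathbb{C}[t] \oplus \mathbb{C}K$.\<close>

definition affine_nonneg :: "('n::finite) affine set" where
  "affine_nonneg = {x. \<forall>m<0. Poly_Mapping.lookup (fst x) m = 0}"


section \<open>Induced modules of Lie superalgebras\<close>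

definition supersign :: "bool \<Rightarrow> bool \<Rightarrow> complex" where
  "supersign p q = (if p \<and> q then -1 else 1)"

text \<open>The tensor algebra of a Lie superalgebra is presented as the quotient of the free associative
  algebra on its underlying set, which has the words \<open>'a list\<close> as a basis.\<close>

type_synonym 'a free_alg = "'a list \<Rightarrow>\<^sub>0 complex"

definition word :: "'a list \<Rightarrow> 'a free_alg" where
  "word w = Poly_Mapping.single w 1"

definition free_scale :: "complex \<Rightarrow> 'a free_alg \<Rightarrow> 'a free_alg" where
  "free_scale c = Poly_Mapping.map ((*) c)"

lemma lookup_free_scale [simp]:
  "Poly_Mapping.lookup (free_scale c f) w = c * Poly_Mapping.lookup f w"
  by (simp add: free_scale_def Poly_Mapping.map.rep_eq when_def)

interpretation free: vector_space "free_scale :: complex \<Rightarrow> 'a free_alg \<Rightarrow> 'a free_alg"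
  by standard (auto intro!: poly_mapping_eqI simp: lookup_add algebra_simps)

text \<open>Left multiplication by a generator.\<close>

definition prepend :: "'a \<Rightarrow> 'a free_alg \<Rightarrow> 'a free_alg" where
  "prepend x f = (\<Sum>w\<in>Poly_Mapping.keys f. Poly_Mapping.single (x # w) (Poly_Mapping.lookup f w))"

text \<open>The two-sided ideal with quotient $U(\mathfrak{a})$, for a Lie superalgebra $\mathfrak{a}$
  given by its scalar multiplication, homogeneous parts and bracket.\<close>

definition enveloping_ideal ::
  "(complex \<Rightarrow> 'a::ab_group_add \<Rightarrow> 'a) \<Rightarrow> (bool \<Rightarrow> 'a set) \<Rightarrow> ('a \<Rightarrow> 'a \<Rightarrow> 'a) \<Rightarrow> 'a free_alg set" where
  "enveloping_ideal s homog br = free.span (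
     {word (u @ [x + y] @ v) - word (u @ [x] @ v) - word (u @ [y] @ v) | u v x y. True} \<union>
     {word (u @ [s c x] @ v) - free_scale c (word (u @ [x] @ v)) | u v c x. True} \<union>
     {word (u @ [x, y] @ v) - free_scale (supersign p q) (word (u @ [y, x] @ v))
        - word (u @ [br x y] @ v) | u v x y p q. x \<in> homog p \<and> y \<in> homog q})"

text \<open>For a subalgebra $\mathfrak{p}$ with a one-dimensional module $\mathbb{C}_\theta$, the induced
  module is $U(\mathfrak{a}) \otimes_{U(\mathfrak{p})} \mathbb{C}_\theta =
  U(\mathfrak{a}) / \sum_{y \in \mathfrak{p}} U(\mathfrak{a}) (y - \theta(y))$; this is the left ideal
  of the free algebra with this quotient.\<close>

definition induced_ideal ::
  "(complex \<Rightarrow> 'a::ab_group_add \<Rightarrow> 'a) \<Rightarrow> (bool \<Rightarrow> 'a set) \<Rightarrow> ('a \<Rightarrow> 'a \<Rightarrow> 'a) \<Rightarrow>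
   'a set \<Rightarrow> ('a \<Rightarrow> complex) \<Rightarrow> 'a free_alg set" where
  "induced_ideal s homog br P \<theta> = free.span (enveloping_ideal s homog br \<union>
     {word (u @ [y]) - free_scale (\<theta> y) (word u) | u y. y \<in> P})"

text \<open>$V^k(\mathfrak{g})$ is the quotient of the free algebra on $\hat{\mathfrak{g}}$ by this left
  ideal, and its highest weight vector $\mathbf{1}$ is the class of the empty word.\<close>

definition vacuum_ideal :: "complex \<Rightarrow> ('n::finite) affine free_alg set" where
  "vacuum_ideal k = induced_ideal affine_scale affine_part affine_bracket affine_nonneg (\<lambda>x. k * snd x)"

definition irreducible_action ::
  "(complex \<Rightarrow> 'v::ab_group_add \<Rightarrow> 'v) \<Rightarrow> ('a \<Rightarrow> 'v \<Rightarrow> 'v) \<Rightarrow> bool" where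
  "irreducible_action sc act \<longleftrightarrow> (UNIV :: 'v set) \<noteq> {0} \<and>
     (\<forall>S. module.subspace sc S \<and> (\<forall>x. act x ` S \<subseteq> S) \<longrightarrow> S = {0} \<or> S = UNIV)"

text \<open>The vector space \<open>'v\<close> with the action \<open>act\<close> of $\hat{\mathfrak{g}}$ and the vector \<open>vac\<close> is
  (a realization of) the irreducible quotient $L_{\mathfrak{g}}(k,0)$: it is irreducible, and \<open>\<pi>\<close>
  induces a surjective homomorphism from $V^k(\mathfrak{g})$ onto it that maps $\mathbf{1}$ to
  \<open>vac\<close>. That \<open>act\<close> is a representation of $\hat{\mathfrak{g}}$ is a consequence.\<close>

definition irreducible_vacuum_quotient ::
  "complex \<Rightarrow> (complex \<Rightarrow> 'v::ab_group_add \<Rightarrow> 'v) \<Rightarrow> (('n::finite) affine \<Rightarrow> 'v \<Rightarrow> 'v) \<Rightarrow> 'v \<Rightarrow> bool" where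
  "irreducible_vacuum_quotient k sc act vac \<longleftrightarrow>
     vector_space sc \<and>
     (\<exists>\<pi>. Vector_Spaces.linear free_scale sc \<pi> \<and> surj \<pi> \<and>
        (\<forall>r\<in>vacuum_ideal k. \<pi> r = 0) \<and>
        (\<forall>x f. \<pi> (prepend x f) = act x (\<pi> f)) \<and>
        \<pi> (word []) = vac) \<and>
     irreducible_action sc act"

inductive homogeneous_word :: "bool \<Rightarrow> ('n::finite) affine list \<Rightarrow> bool" where
  "homogeneous_word False []"
| "x \<in> affine_part p \<Longrightarrow> homogeneous_word q w \<Longrightarrow> homogeneous_word (p \<noteq> q) (x # w)"

text \<open>The superspace structure induced from $U(\hat{\mathfrak{g}})$, with $\mathbf{1}$ even.\<close>

definition module_part ::
  "(complex \<Rightarrow> 'v::ab_group_add \<Rightarrow> 'v) \<Rightarrow> (('n::finite) affine \<Rightarrow> 'v \<Rightarrow> 'v) \<Rightarrow> 'v \<Rightarrow> bool \<Rightarrow> 'v set" where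
  "module_part sc act vac p = module.span sc {foldr act w vac | w. homogeneous_word p w}"

definition sugawara_vector ::
  "complex \<Rightarrow> (complex \<Rightarrow> 'v::ab_group_add \<Rightarrow> 'v) \<Rightarrow> (('n::finite) affine \<Rightarrow> 'v \<Rightarrow> 'v) \<Rightarrow> 'v \<Rightarrow>
   nat \<Rightarrow> (nat \<Rightarrow> 'n osp) \<Rightarrow> (nat \<Rightarrow> 'n osp) \<Rightarrow> 'v" where
  "sugawara_vector k sc act vac d a b =
     sc (1 / (2 * (k + dual_coxeter TYPE('n))))
       (\<Sum>i<d. act (mode (a i) (-1)) (act (mode (b i) (-1)) vac))"


section \<open>Vertex operator superalgebras\<close>

text \<open>\<open>Y u m v\<close> is $u_m v$, where $Y(u,z) = \sum_m u_m z^{-m-1}$. The Jacobi identity is given in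
  components (the Borcherds identity); by \<open>truncation\<close> both sums are finite. The \<open>L(0)\<close>-grading is by
  half-integers and not tied to the parity.\<close>

locale vertex_operator_superalgebra = vector_space sc
  for sc :: "complex \<Rightarrow> 'v::ab_group_add \<Rightarrow> 'v" +
  fixes homog :: "bool \<Rightarrow> 'v set"
    and Y :: "'v \<Rightarrow> int \<Rightarrow> 'v \<Rightarrow> 'v"
    and vac \<omega> :: 'v
  assumes part_subspace: "subspace (homog p)"
    and part_disjoint: "homog False \<inter> homog True = {0}"
    and part_sum: "\<exists>u\<in>homog False. \<exists>v\<in>homog True. w = u + v"
    and Y_linear_left: "Vector_Spaces.linear sc sc (\<lambda>u. Y u m v)"
    and Y_linear_right: "Vector_Spaces.linear sc sc (Y u m)"
    and Y_parity: "u \<in> homog p \<Longrightarrow> v \<in> homog q \<Longrightarrow> Y u m v \<in> homog (p \<noteq> q)"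
    and truncation: "\<exists>N. \<forall>m\<ge>N. Y u m v = 0"
    and vac_even: "vac \<in> homog False"
    and vac_field: "Y vac m v = (if m = -1 then v else 0)"
    and creation: "Y u (-1) vac = u" "m \<ge> 0 \<Longrightarrow> Y u m vac = 0"
    and Borcherds: "u \<in> homog p \<Longrightarrow> v \<in> homog q \<Longrightarrow>
      Sum_any (\<lambda>i::nat. sc (of_int m gchoose i) (Y (Y u (l + int i) v) (m + n - int i) w)) =
      Sum_any (\<lambda>i::nat. sc ((-1) ^ i * (of_int l gchoose i))
        (Y u (m + l - int i) (Y v (n + int i) w)
          - sc (supersign p q * (-1) powi l) (Y v (n + l - int i) (Y u (m + int i) w))))"
    and conformal_even: "\<omega> \<in> homog False"
    and Virasoro: "\<exists>c. \<forall>i j v.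
      Y \<omega> (i + 1) (Y \<omega> (j + 1) v) - Y \<omega> (j + 1) (Y \<omega> (i + 1) v) =
      sc (of_int (i - j)) (Y \<omega> (i + j + 1) v)
        + sc (if i + j = 0 then of_int (i ^ 3 - i) / 12 * c else 0) v"
    and L_neg_one_derivative: "Y (Y \<omega> 0 u) m v = - sc (of_int m) (Y u (m - 1) v)"
    and L0_grading: "span (\<Union>r::int. {v. Y \<omega> 1 v = sc (of_int r / 2) v}) = UNIV"
    and L0_finite_dim: "\<exists>B. finite B \<and> {v. Y \<omega> 1 v = sc (of_int r / 2) v} \<subseteq> span B"
    and L0_bounded_below: "\<exists>N::int. \<forall>r<N. {v. Y \<omega> 1 v = sc (of_int r / 2) v} = {0}"

definition C2_subspace ::
  "(complex \<Rightarrow> 'v::ab_group_add \<Rightarrow> 'v) \<Rightarrow> ('v \<Rightarrow> int \<Rightarrow> 'v \<Rightarrow> 'v) \<Rightarrow> 'v set" where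
  "C2_subspace sc Y = module.span sc {Y u (-2) v | u v. True}"

text \<open>$\dim V / C_2(V) < \infty$: the cosets of some finite set span the quotient.\<close>

definition C2_cofinite ::
  "(complex \<Rightarrow> 'v::ab_group_add \<Rightarrow> 'v) \<Rightarrow> ('v \<Rightarrow> int \<Rightarrow> 'v \<Rightarrow> 'v) \<Rightarrow> bool" where
  "C2_cofinite sc Y \<longleftrightarrow>
     (\<exists>B. finite B \<and> (\<forall>v. \<exists>b\<in>module.span sc B. v - b \<in> C2_subspace sc Y))"

end

theory Submission
  imports Defs
begin

text \<open>
  Modulo \<open>C2\<close> the operators \<open>x(-1)\<close> supercommute, and the images of the vectors
  \<open>x\<^sub>1(-1) \<dots> x\<^sub>r(-1) vac\<close> span the quotient. So the quotient has finite dimension as soon as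
  \<open>osp(1|2n)\<close> is spanned by finitely many homogeneous elements \<open>g\<close> for which \<open>g(-1)\<close> is nilpotent
  modulo \<open>C2\<close>: only ordered monomials with bounded exponents remain
  (\<open>finite_span_of_nilpotent_operators\<close>). An odd \<open>x\<close> always has this property, because \<open>x(-1)\<^sup>2\<close> is
  half of \<open>[x,x](-2)\<close>. The even part \<open>sp(2n)\<close> is spanned by long root vectors, the matrices
  \<open>v v\<^sup>T J\<close> of rank one (\<open>even_part_spanned_by_long_roots\<close>), so it remains to prove the
  integrability \<open>e(-1)^(k+1) vac = 0\<close> for each long root vector \<open>e\<close>
  (\<open>long_root_power_vanishes\<close>).

  Let \<open>w = e(-1)^(k+1) vac\<close>. From \<open>[[x,e],e] = -2 (x|e) e\<close> one obtains
  \<open>x(1) e(-1)^(j+1) vac = (x|e) (j+1) (k-j) e(-1)^j vac\<close>, which vanishes for \<open>j = k\<close>; thus \<open>w\<close> is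
  killed by all modes \<open>x(m)\<close> with \<open>m > 0\<close>. If \<open>w\<close> were nonzero, irreducibility would make the
  module the span of the vectors obtained from \<open>w\<close> by modes \<open>x(m)\<close> with \<open>m \<le> 0\<close>
  (\<open>generated_by_lower_modes\<close>). All of these have \<open>L(0)\<close>-weight at least \<open>k+1\<close>, whereas the vacuum
  has weight 0.

  The weight argument rests on \<open>[L(0), x(m)] = - m x(m)\<close> (\<open>weight_mode\<close>). Invariance of the Casimir
  tensor gives \<open>x(0) \<omega> = 0\<close>, and \<open>x(1) \<omega>\<close> has the form \<open>z(-1) vac\<close>. The commutator formula then
  reads \<open>[x(m), \<omega>\<^sub>n] = m z(m+n-1)\<close> for \<open>n = 0, 1\<close>; comparing the case \<open>n = 0\<close> with the
  \<open>L(-1)\<close>-derivative property yields \<open>z = x\<close>, and the case \<open>n = 1\<close> is the claim.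
\<close>


section \<open>The invariant form and its Casimir tensor\<close>

text \<open>Conjugation by the parity matrix: the sign that arises when an odd element passes \<open>A\<close>.\<close>

definition twist_mat :: "('n::finite) gl \<Rightarrow> 'n gl" where
  "twist_mat A = even_mat A - odd_mat A"

lemma twist_mat_entry: "twist_mat A $ i $ j = (if odd_index i = odd_index j then 1 else -1) * A $ i $ j"
  by (simp add: twist_mat_def even_mat_def odd_mat_def)

lemma twist_mat_mult: "twist_mat (A ** B) = twist_mat A ** twist_mat B"
  by (simp add: twist_mat_def even_mat_mult odd_mat_mult matrix_minus_distrib)

lemma twist_mat_twist_mat: "twist_mat (twist_mat A) = A"
  by (simp add: vec_eq_iff twist_mat_entry)

lemma supertrace_arith:
  "supertrace (A + B) = supertrace A + supertrace B"
  "supertrace (A - B) = supertrace A - supertrace B"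
  "supertrace (- A) = - supertrace A"
  "supertrace (map_matrix ((*) c) A) = c * supertrace A"
  by (simp_all add: supertrace_def sum.distrib sum_subtractf sum_negf sum_distrib_left
      map_matrix_def algebra_simps)

lemma supertrace_twist_mat: "supertrace (twist_mat A) = supertrace A"
  by (simp add: supertrace_def twist_mat_entry)

text \<open>The supertrace is the trace of \<open>P A\<close> with \<open>P\<close> the parity matrix, so cyclicity of the trace turns
  into cyclicity up to conjugation by \<open>P\<close>.\<close>

lemma supertrace_mult_commute: "supertrace (A ** B) = supertrace (twist_mat B ** A)"
proof -
  define s :: "('a + 'a) option \<Rightarrow> complex" where "s i = (if odd_index i then -1 else 1)" for i
  have "supertrace (A ** B) = (\<Sum>i\<in>UNIV. \<Sum>j\<in>UNIV. s i * A $ i $ j * B $ j $ i)"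
    by (simp add: supertrace_def s_def matrix_matrix_mult_def sum_distrib_left mult.assoc)
  also have "\<dots> = (\<Sum>j\<in>UNIV. \<Sum>i\<in>UNIV. s i * A $ i $ j * B $ j $ i)"
    by (rule sum.swap)
  also have "\<dots> = supertrace (twist_mat B ** A)"
    by (auto simp: supertrace_def s_def matrix_matrix_mult_def sum_distrib_left twist_mat_entry
        intro!: sum.cong)
  finally show ?thesis .
qed

lift_definition osp_even :: "('n::finite) osp \<Rightarrow> 'n osp" is even_mat
  by (simp add: preserves_form_def even_mat_simps odd_mat_simps transpose_arith)

lift_definition osp_odd :: "('n::finite) osp \<Rightarrow> 'n osp" is odd_mat
  by (simp add: preserves_form_def even_mat_simps odd_mat_simps transpose_arith)

text \<open>The operator by which an element of parity \<open>p\<close> supercommutes past another element. With it the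
  sign rules hold for an inhomogeneous second argument too, as is needed for dual bases, whose members
  need not be homogeneous.\<close>

definition osp_twist :: "bool \<Rightarrow> ('n::finite) osp \<Rightarrow> 'n osp" where
  "osp_twist p x = (if p then osp_even x - osp_odd x else x)"

lemma Rep_osp_twist: "Rep_osp (osp_twist p x) = (if p then twist_mat (Rep_osp x) else Rep_osp x)"
  by (simp add: osp_twist_def twist_mat_def minus_osp.rep_eq osp_even.rep_eq osp_odd.rep_eq)

lemma osp_twist_twist: "osp_twist p (osp_twist p x) = x"
  by (simp add: Rep_osp_inject[symmetric] Rep_osp_twist twist_mat_twist_mat)

lemma osp_even_plus_odd: "osp_even x + osp_odd x = x"
  by transfer (rule even_plus_odd_mat)

lemma osp_part_even [simp]: "osp_even x \<in> osp_part False"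
  by (simp add: osp_part_def osp_even.rep_eq odd_mat_simps)

lemma osp_part_odd [simp]: "osp_odd x \<in> osp_part True"
  by (simp add: osp_part_def osp_odd.rep_eq even_mat_simps)

lemma osp_part_0 [simp]: "0 \<in> osp_part p"
  by (simp add: osp_part_def zero_osp.rep_eq even_mat_simps odd_mat_simps)

lemma osp_even_eq: "x \<in> osp_part False \<Longrightarrow> osp_even x = x"
  using even_plus_odd_mat[of "Rep_osp x"]
  by (simp add: osp_part_def Rep_osp_inject[symmetric] osp_even.rep_eq)

lemma osp_twist_part:
  assumes "a \<in> osp_part q" shows "osp_twist p a = osp_scale (supersign p q) a"
proof (cases "p \<and> q")
  case True
  then have "even_mat (Rep_osp a) = 0" using assms by (simp add: osp_part_def)
  then have "osp_even a = 0" by (simp add: Rep_osp_inject[symmetric] osp_even.rep_eq zero_osp.rep_eq)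
  then have "osp_twist p a = - a"
    using True osp_even_plus_odd[of a] by (simp add: osp_twist_def)
  then show ?thesis using True by (simp add: supersign_def)
next
  case False
  have "osp_twist p a = a"
  proof (cases p)
    case True
    then have "a \<in> osp_part False" using False assms by (cases q) auto
    then have "osp_even a = a" by (rule osp_even_eq)
    then show ?thesis using True osp_even_plus_odd[of a] by (simp add: osp_twist_def)
  qed (simp add: osp_twist_def)
  moreover have "supersign p q = 1" using False by (auto simp: supersign_def)
  ultimately show ?thesis by simp
qed

lemma osp_twist_add: "osp_twist p (a + b) = osp_twist p a + osp_twist p b"
  by (simp add: Rep_osp_inject[symmetric] Rep_osp_twist plus_osp.rep_eq vec_eq_iff twist_mat_entry
      algebra_simps)

lemma Rep_bracket_left:
  assumes "x \<in> osp_part p"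
  shows "Rep_osp (osp_bracket x a) = Rep_osp x ** Rep_osp a - Rep_osp (osp_twist p a) ** Rep_osp x"
proof (cases p)
  case True
  then have "even_mat (Rep_osp x) = 0" "odd_mat (Rep_osp x) = Rep_osp x"
    using assms even_plus_odd_mat[of "Rep_osp x"] by (auto simp: osp_part_def)
  then show ?thesis using True
    by (simp add: osp_bracket.rep_eq supercomm_def Rep_osp_twist twist_mat_def matrix_minus_distrib)
next
  case False
  then have *: "odd_mat (Rep_osp x) = 0" "even_mat (Rep_osp x) = Rep_osp x"
    using assms even_plus_odd_mat[of "Rep_osp x"] by (auto simp: osp_part_def)
  show ?thesis using False
    by (simp add: osp_bracket.rep_eq supercomm_def Rep_osp_twist twist_mat_def *
        even_plus_odd_mat flip: matrix_add_distrib)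
qed

lemma Rep_bracket_right:
  assumes "x \<in> osp_part p"
  shows "Rep_osp (osp_bracket b x) = Rep_osp b ** Rep_osp x - Rep_osp x ** Rep_osp (osp_twist p b)"
proof (cases p)
  case True
  then have "even_mat (Rep_osp x) = 0" "odd_mat (Rep_osp x) = Rep_osp x"
    using assms even_plus_odd_mat[of "Rep_osp x"] by (auto simp: osp_part_def)
  then show ?thesis using True
    by (simp add: osp_bracket.rep_eq supercomm_def Rep_osp_twist twist_mat_def matrix_minus_distrib)
next
  case False
  then have *: "odd_mat (Rep_osp x) = 0" "even_mat (Rep_osp x) = Rep_osp x"
    using assms even_plus_odd_mat[of "Rep_osp x"] by (auto simp: osp_part_def)
  show ?thesis using False
    by (simp add: osp_bracket.rep_eq supercomm_def Rep_osp_twist twist_mat_def *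
        even_plus_odd_mat flip: matrix_add_distrib)
qed

lemma bracket_skew:
  assumes "x \<in> osp_part p"
  shows "osp_bracket b x = - osp_bracket x (osp_twist p b)"
  unfolding Rep_osp_inject[symmetric] uminus_osp.rep_eq Rep_bracket_left[OF assms]
    Rep_bracket_right[OF assms]
  by (simp add: Rep_osp_twist twist_mat_twist_mat)

lemma supercomm_bilinear:
  "supercomm (A + B) C = supercomm A C + supercomm B C"
  "supercomm C (A + B) = supercomm C A + supercomm C B"
  "supercomm (map_matrix ((*) c) A) B = map_matrix ((*) c) (supercomm A B)"
  "supercomm A (map_matrix ((*) c) B) = map_matrix ((*) c) (supercomm A B)"
     apply (simp_all add: supercomm_def even_mat_simps odd_mat_simps matrix_add_distrib
      map_matrix_scale_mult)
   apply (simp_all add: vec_eq_iff map_matrix_def algebra_simps)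
  done

lemma bracket_add:
  "osp_bracket (x + y) z = osp_bracket x z + osp_bracket y z"
  "osp_bracket z (x + y) = osp_bracket z x + osp_bracket z y"
  by (transfer, rule supercomm_bilinear)+

lemma bracket_scale:
  "osp_bracket (osp_scale c x) z = osp_scale c (osp_bracket x z)"
  "osp_bracket z (osp_scale c x) = osp_scale c (osp_bracket z x)"
  by (transfer, rule supercomm_bilinear)+

lemma bracket_zero [simp]: "osp_bracket 0 z = 0" "osp_bracket z 0 = 0"
  using bracket_add(1)[of 0 0 z] bracket_add(2)[of z 0 0] by simp_all

lemma form_add:
  "osp_form (x + y) z = osp_form x z + osp_form y z"
  "osp_form z (x + y) = osp_form z x + osp_form z y"
  by (simp_all add: osp_form_def plus_osp.rep_eq matrix_add_distrib supertrace_arith)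

lemma form_scale:
  "osp_form (osp_scale c x) z = c * osp_form x z"
  "osp_form z (osp_scale c x) = c * osp_form z x"
  by (simp_all add: osp_form_def osp_scale.rep_eq map_matrix_scale_mult supertrace_arith)

lemma form_zero [simp]: "osp_form 0 z = 0" "osp_form z 0 = 0"
  using form_add(1)[of 0 0 z] form_add(2)[of z 0 0] by simp_all

lemma form_minus:
  "osp_form (x - y) z = osp_form x z - osp_form y z"
  "osp_form z (x - y) = osp_form z x - osp_form z y"
  by (simp_all add: osp_form_def minus_osp.rep_eq matrix_minus_distrib supertrace_arith)

lemma form_sum:
  "osp_form (\<Sum>i\<in>I. f i) z = (\<Sum>i\<in>I. osp_form (f i) z)"
  "osp_form z (\<Sum>i\<in>I. f i) = (\<Sum>i\<in>I. osp_form z (f i))"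
  by (induction I rule: infinite_finite_induct) (simp_all add: form_add)

lemma form_supersymmetric: "osp_form x y = osp_form (osp_twist True y) x"
  by (simp add: osp_form_def Rep_osp_twist flip: supertrace_mult_commute)

lemma form_twist: "osp_form (osp_twist p x) (osp_twist p y) = osp_form x y"
  by (simp add: osp_form_def Rep_osp_twist supertrace_twist_mat flip: twist_mat_mult)

lemma form_invariant:
  assumes "x \<in> osp_part p"
  shows "osp_form (osp_bracket b x) a = osp_form b (osp_bracket x a)"
proof -
  define X A B where "X = Rep_osp x" and "A = Rep_osp a" and "B = Rep_osp b"
  define t :: "'a gl \<Rightarrow> 'a gl" where "t = (if p then twist_mat else id)"
  have X: "twist_mat X = (if p then - X else X)"
    using assms even_plus_odd_mat[of X] by (auto simp: X_def osp_part_def twist_mat_def)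
  \<comment> \<open>For odd \<open>X\<close> the two signs, from cyclicity and from moving the twist to \<open>B\<close>, cancel.\<close>
  have *: "supertrace (X ** t B ** A) = supertrace (B ** t A ** X)"
  proof -
    have "supertrace (B ** t A ** X) = supertrace (twist_mat X ** (B ** t A))"
      by (rule supertrace_mult_commute)
    also have "\<dots> = supertrace (X ** t B ** A)"
    proof (cases p)
      case True
      have "supertrace (X ** t B ** A) = supertrace (twist_mat (X ** t B ** A))"
        by (simp add: supertrace_twist_mat)
      also have "\<dots> = supertrace (twist_mat X ** (B ** t A))"
        using True by (simp add: twist_mat_mult t_def twist_mat_twist_mat matrix_mul_assoc)
      finally show ?thesis by simp
    qed (simp add: X t_def matrix_mul_assoc)
    finally show ?thesis by simp
  qed
  have r: "Rep_osp (osp_twist p c) = t (Rep_osp c)" for c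
    by (simp add: Rep_osp_twist t_def)
  show ?thesis
    unfolding osp_form_def Rep_bracket_left[OF assms] Rep_bracket_right[OF assms] r
    using * by (simp add: matrix_minus_distrib supertrace_arith matrix_mul_assoc X_def A_def B_def)
qed

lemma dual_bases_expand_left:
  fixes x :: "('n::finite) osp" and a b :: "nat \<Rightarrow> 'n osp"
  assumes "dual_bases d a b"
  shows "x = (\<Sum>i<d. osp_scale (osp_form (b i) x) (a i))"
proof -
  define S where "S = {x :: 'n osp. x = (\<Sum>i<d. osp_scale (osp_form (b i) x) (a i))}"
  have "osp.subspace S"
  proof (rule osp.subspaceI)
    show "0 \<in> S" by (simp add: S_def)
    show "x + y \<in> S" if "x \<in> S" "y \<in> S" for x y
      using that by (simp add: S_def form_add osp.scale_left_distrib sum.distrib)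
    show "osp_scale c x \<in> S" if "x \<in> S" for c x
    proof -
      have "osp_scale c x = osp_scale c (\<Sum>i<d. osp_scale (osp_form (b i) x) (a i))"
        using that by (simp add: S_def)
      also have "\<dots> = (\<Sum>i<d. osp_scale (osp_form (b i) (osp_scale c x)) (a i))"
        by (simp add: form_scale osp.scale_sum_right)
      finally show ?thesis unfolding S_def by blast
    qed
  qed
  moreover have "a ` {..<d} \<subseteq> S"
  proof
    fix y assume "y \<in> a ` {..<d}"
    then obtain j where j: "j < d" "y = a j" by auto
    have "(\<Sum>i<d. osp_scale (osp_form (b i) (a j)) (a i)) = (\<Sum>i<d. if i = j then a i else 0)"
      using assms j by (intro sum.cong) (auto simp: dual_bases_def)
    then show "y \<in> S" using j by (simp add: S_def)
  qed
  ultimately have "osp.span (a ` {..<d}) \<subseteq> S" by (rule osp.span_minimal[rotated])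
  then show ?thesis using assms by (auto simp: dual_bases_def S_def)
qed

text \<open>The existence of dual bases gives nondegeneracy in the second argument; supersymmetry carries it
  over to the first.\<close>

lemma form_nondegenerate:
  fixes x :: "('n::finite) osp" and a b :: "nat \<Rightarrow> 'n osp"
  assumes "dual_bases d a b" and "\<And>y. osp_form x y = 0"
  shows "x = 0"
proof -
  have "osp_form (b i) x = 0" for i
    using assms(2)[of "osp_twist True (b i)"] form_supersymmetric[of x "osp_twist True (b i)"]
    by (simp add: osp_twist_twist)
  then show ?thesis using dual_bases_expand_left[OF assms(1), of x] by simp
qed

lemma dual_bases_expand_right:
  fixes y :: "('n::finite) osp" and a b :: "nat \<Rightarrow> 'n osp"
  assumes "dual_bases d a b"
  shows "y = (\<Sum>i<d. osp_scale (osp_form y (a i)) (b i))"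
proof -
  define z where "z = y - (\<Sum>i<d. osp_scale (osp_form y (a i)) (b i))"
  have 0: "osp_form z (a j) = 0" if "j < d" for j
  proof -
    have "(\<Sum>i<d. osp_form y (a i) * osp_form (b i) (a j)) = (\<Sum>i<d. if i = j then osp_form y (a i) else 0)"
      using assms that by (intro sum.cong) (auto simp: dual_bases_def)
    then show ?thesis using that by (simp add: z_def form_minus form_sum form_scale)
  qed
  have "osp_form z x = 0" for x
  proof -
    have "osp_form z x = osp_form z (\<Sum>i<d. osp_scale (osp_form (b i) x) (a i))"
      using dual_bases_expand_left[OF assms, of x] by simp
    also have "\<dots> = (\<Sum>i<d. osp_form (b i) x * osp_form z (a i))"
      by (simp only: form_sum form_scale)
    also have "\<dots> = 0" by (simp add: 0)
    finally show ?thesis .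
  qed
  then have "z = 0" by (rule form_nondegenerate[OF assms])
  then show ?thesis by (simp add: z_def)
qed


section \<open>Long root vectors\<close>

text \<open>The Gram matrix is monomial: column \<open>j\<close> has its single nonzero entry \<open>gram_sign j\<close> in row
  \<open>partner j\<close>. So products with it need no summation.\<close>

fun partner :: "('n + 'n) option \<Rightarrow> ('n + 'n) option" where
  "partner None = None"
| "partner (Some (Inl a)) = Some (Inr a)"
| "partner (Some (Inr a)) = Some (Inl a)"

fun gram_sign :: "('n + 'n) option \<Rightarrow> complex" where
  "gram_sign (Some (Inl a)) = -1"
| "gram_sign _ = 1"

lemma partner_partner [simp]: "partner (partner i) = i"
  by (cases i rule: partner.cases) auto

lemma partner_eq_iff: "i = partner j \<longleftrightarrow> j = partner i"
  by (metis partner_partner)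

lemma partner_None_iff [simp]: "partner i = None \<longleftrightarrow> i = None" "None = partner i \<longleftrightarrow> i = None"
  by (cases i rule: partner.cases; simp)+

lemma gram_sign_square [simp]: "gram_sign i * gram_sign i = 1"
  by (cases i rule: gram_sign.cases) auto

lemma gram_sign_partner: "i \<noteq> None \<Longrightarrow> gram_sign (partner i) = - gram_sign i"
  by (cases i rule: partner.cases) auto

lemma gram_entry_partner: "gram_entry i j = (if i = partner j then gram_sign j else 0)"
  by (cases "(i, j)" rule: gram_entry.cases) auto

lemma mult_gram_entry: "(A ** gram) $ i $ j = A $ i $ partner j * gram_sign j"
  by (simp add: matrix_matrix_mult_def gram_def gram_entry_partner if_distrib[where f = "\<lambda>x. _ * x"]
      cong: if_cong)

lemma gram_mult_entry: "(gram ** A) $ i $ j = gram_sign (partner i) * A $ partner i $ j"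
  by (simp add: matrix_matrix_mult_def gram_def gram_entry_partner partner_eq_iff[of i]
      if_distrib[where f = "\<lambda>x. x * _"] cong: if_cong)

text \<open>Cutting off the even coordinate makes \<open>v v\<^sup>T J\<close> an element of \<open>sp(2n)\<close> for every \<open>v\<close>, so that long
  root vectors can be indexed by a whole vector space.\<close>

definition odd_vec :: "complex ^ (('n::finite + 'n) option) \<Rightarrow> complex ^ (('n + 'n) option)" where
  "odd_vec v = (\<chi> i. if i = None then 0 else v $ i)"

text \<open>The matrix \<open>u u\<^sup>T J\<close>, where \<open>u\<close> is the odd part of \<open>v\<close> and \<open>J\<close> is the Gram matrix.\<close>

definition rank_one_mat :: "complex ^ (('n::finite + 'n) option) \<Rightarrow> 'n gl" where
  "rank_one_mat v = (\<chi> i j. odd_vec v $ i * (odd_vec v $ partner j * gram_sign j))"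

lemma odd_vec_None [simp]: "odd_vec v $ None = 0"
  by (simp add: odd_vec_def)

lemma even_rank_one_mat: "even_mat (rank_one_mat v) = rank_one_mat v"
  by (auto simp: even_mat_def rank_one_mat_def vec_eq_iff odd_index_def)

lemma odd_rank_one_mat: "odd_mat (rank_one_mat v) = 0"
  by (auto simp: odd_mat_def rank_one_mat_def vec_eq_iff odd_index_def)

lift_definition long_root_vector :: "complex ^ (('n::finite + 'n) option) \<Rightarrow> 'n osp" is rank_one_mat
proof -
  fix v :: "complex ^ (('n + 'n) option)"
  have "(transpose (rank_one_mat v) ** gram + gram ** rank_one_mat v) $ i $ j = 0" for i j
    by (cases "i = None"; cases "j = None")
      (simp_all add: mult_gram_entry gram_mult_entry, simp_all add: transpose_def rank_one_mat_def
        gram_sign_partner)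
  then show "preserves_form (rank_one_mat v)"
    by (simp add: preserves_form_def even_rank_one_mat odd_rank_one_mat transpose_arith vec_eq_iff)
qed

lemma long_root_vector_even: "long_root_vector v \<in> osp_part False"
  by (simp add: osp_part_def long_root_vector.rep_eq odd_rank_one_mat)

text \<open>With \<open>E = v v\<^sup>T J\<close> the product is \<open>E X E = v (v\<^sup>T J X v) v\<^sup>T J\<close>, and the scalar in the middle is the trace
  of \<open>X E\<close>. On the odd block the supertrace is minus the trace.\<close>

lemma rank_one_sandwich:
  "rank_one_mat v ** X ** rank_one_mat v =
     map_matrix ((*) (- supertrace (X ** rank_one_mat v))) (rank_one_mat v)"
proof -
  define w where "w = odd_vec v"
  have st: "- supertrace (X ** rank_one_mat v) =
     (\<Sum>i\<in>UNIV. \<Sum>j\<in>UNIV. w $ partner i * gram_sign i * X $ i $ j * w $ j)"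
    unfolding supertrace_def sum_negf[symmetric]
  proof (intro sum.cong refl)
    fix i
    show "- ((if odd_index i then - 1 else 1) * (X ** rank_one_mat v) $ i $ i) =
        (\<Sum>j\<in>UNIV. w $ partner i * gram_sign i * X $ i $ j * w $ j)"
      by (cases "i = None")
        (simp_all add: odd_index_def matrix_matrix_mult_def rank_one_mat_def w_def sum_distrib_left
          sum_negf mult_ac)
  qed
  have "(rank_one_mat v ** X ** rank_one_mat v) $ k $ l =
      w $ k * (w $ partner l * gram_sign l) *
        (\<Sum>j\<in>UNIV. \<Sum>i\<in>UNIV. w $ partner i * gram_sign i * X $ i $ j * w $ j)" for k l
    by (simp add: matrix_matrix_mult_def rank_one_mat_def w_def sum_distrib_left sum_distrib_right mult_ac)
  then show ?thesis
    unfolding st by (subst (asm) sum.swap) (simp add: vec_eq_iff map_matrix_def rank_one_mat_def w_def mult_ac)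
qed

text \<open>The scalar \<open>v\<^sup>T J v\<close> vanishes because \<open>J\<close> is skew on the odd part.\<close>

lemma rank_one_square: "rank_one_mat v ** rank_one_mat v = 0"
proof -
  define w where "w = odd_vec v"
  define s where "s = (\<Sum>i\<in>UNIV. w $ partner i * gram_sign i * w $ i)"
  have "s = (\<Sum>i\<in>UNIV. w $ i * gram_sign (partner i) * w $ partner i)"
    unfolding s_def by (rule sum.reindex_bij_witness[of _ partner partner]) auto
  also have "\<dots> = - s"
    unfolding s_def sum_negf[symmetric]
  proof (intro sum.cong refl)
    fix i
    show "w $ i * gram_sign (partner i) * w $ partner i = - (w $ partner i * gram_sign i * w $ i)"
      by (cases "i = None") (simp_all add: w_def gram_sign_partner)
  qed
  finally have "s = 0" by simp
  moreover have "(rank_one_mat v ** rank_one_mat v) $ k $ l = w $ k * (w $ partner l * gram_sign l) * s" for k l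
    by (simp add: matrix_matrix_mult_def rank_one_mat_def w_def s_def sum_distrib_left mult_ac)
  ultimately show ?thesis by (simp add: vec_eq_iff)
qed

lemma long_root_bracket_self: "osp_bracket (long_root_vector v) (long_root_vector v) = 0"
  unfolding Rep_osp_inject[symmetric] Rep_bracket_right[OF long_root_vector_even]
  by (simp add: Rep_osp_twist long_root_vector.rep_eq zero_osp.rep_eq)

text \<open>In \<open>X E E - 2 E X E + E E X\<close> only the middle term survives.\<close>

lemma long_root_double_bracket:
  "osp_bracket (osp_bracket x (long_root_vector v)) (long_root_vector v) =
     osp_scale (- 2 * osp_form x (long_root_vector v)) (long_root_vector v)"
proof -
  let ?E = "rank_one_mat v" and ?X = "Rep_osp x"
  have "Rep_osp (osp_bracket (osp_bracket x (long_root_vector v)) (long_root_vector v)) =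
      (?X ** ?E - ?E ** ?X) ** ?E - ?E ** (?X ** ?E - ?E ** ?X)"
    by (simp add: Rep_bracket_right[OF long_root_vector_even] Rep_osp_twist long_root_vector.rep_eq)
  also have "\<dots> = ?X ** (?E ** ?E) - ?E ** ?X ** ?E - ?E ** ?X ** ?E + (?E ** ?E) ** ?X"
    by (simp add: matrix_minus_distrib matrix_mul_assoc)
  also have "\<dots> = map_matrix ((*) (- 2 * - supertrace (?X ** ?E))) ?E"
    unfolding rank_one_sandwich rank_one_square
    by (simp add: vec_eq_iff map_matrix_def algebra_simps)
  finally show ?thesis
    by (simp add: Rep_osp_inject[symmetric] osp_scale.rep_eq osp_form_def long_root_vector.rep_eq)
qed

text \<open>If \<open>A\<close> is the matrix of \<open>x\<close>, then \<open>A\<close> is the sum over \<open>p\<close> of \<open>(A e\<^sub>p) (J e\<^sub>p)\<^sup>T J\<close>, and since \<open>A\<close> preserves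
  the form it is also the sum of the exchanged products \<open>(J e\<^sub>p) (A e\<^sub>p)\<^sup>T J\<close>. Adding the two,
  \<open>2 A\<close> is a sum of polarizations of the quadratic map \<open>v \<mapsto> v v\<^sup>T J\<close>.\<close>

lemma even_part_spanned_by_long_roots:
  fixes x :: "('n::finite) osp"
  assumes "x \<in> osp_part False"
  shows "x \<in> osp.span (range long_root_vector)"
proof -
  define A where "A = Rep_osp x"
  have A: "even_mat A = A" and pf: "preserves_form A"
    using assms even_plus_odd_mat[of A] Rep_osp[of x] by (auto simp: osp_part_def A_def)
  have rel: "A $ partner j $ i * gram_sign j + gram_sign (partner i) * A $ partner i $ j = 0" for i j
  proof -
    have "(transpose A ** gram + gram ** A) $ i $ j = 0"
      using pf by (simp add: preserves_form_def A)
    then show ?thesis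
      by (simp add: mult_gram_entry gram_mult_entry) (simp add: transpose_def)
  qed
  have off: "A $ i $ None = 0" "A $ None $ i = 0" for i
  proof -
    have "A $ None $ None = 0" using rel[of None None] by simp
    moreover have "A $ i $ None = 0" "A $ None $ i = 0" if "i \<noteq> None"
    proof -
      have "even_mat A $ i $ None = 0" "even_mat A $ None $ i = 0"
        using that by (simp_all add: even_mat_def odd_index_def del: not_None_eq)
      then show "A $ i $ None = 0" "A $ None $ i = 0" by (simp_all only: A)
    qed
    ultimately show "A $ i $ None = 0" "A $ None $ i = 0" by metis+
  qed
  define c g :: "('n + 'n) option \<Rightarrow> complex ^ (('n + 'n) option)"
    where "c p = (\<chi> i. A $ i $ p)" and "g p = (\<chi> i. gram_entry i p)" for p
  define y where "y = (\<Sum>p\<in>UNIV. long_root_vector (c p + g p) - long_root_vector (c p) - long_root_vector (g p))"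
  have Rep_sum: "Rep_osp (\<Sum>p\<in>P. f p) $ i $ j = (\<Sum>p\<in>P. Rep_osp (f p) $ i $ j)"
    for f :: "('n + 'n) option \<Rightarrow> 'n osp" and P i j
    by (induction P rule: infinite_finite_induct) (simp_all add: zero_osp.rep_eq plus_osp.rep_eq)
  have "Rep_osp y $ i $ j = 2 * A $ i $ j" for i j
  proof (cases "i = None \<or> j = None")
    case True
    then show ?thesis
      by (auto simp: y_def Rep_sum minus_osp.rep_eq long_root_vector.rep_eq rank_one_mat_def off)
  next
    case False
    have "Rep_osp y $ i $ j = (\<Sum>p\<in>UNIV. (A $ i $ p * gram_entry (partner j) p
        + gram_entry i p * A $ partner j $ p) * gram_sign j)"
      unfolding y_def Rep_sum
      by (rule sum.cong[OF refl], use False in \<open>simp del: not_None_eq add: minus_osp.rep_eq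
        long_root_vector.rep_eq rank_one_mat_def odd_vec_def c_def g_def\<close>, simp add: algebra_simps)
    also have "\<dots> = (A $ i $ j * gram_sign j + gram_sign (partner i) * A $ partner j $ partner i) * gram_sign j"
      by (simp add: gram_entry_partner partner_eq_iff[of _ "_ :: ('n + 'n) option"] sum.distrib
          if_distrib[where f = "\<lambda>x. _ * x"] if_distrib[where f = "\<lambda>x. x * _"]
          flip: sum_distrib_right cong: if_cong)
    also have "\<dots> = 2 * A $ i $ j"
    proof -
      have "A $ partner j $ partner i * gram_sign j = - gram_sign i * A $ i $ j"
        using rel[of j "partner i"] by (simp add: eq_neg_iff_add_eq_0)
      then have "gram_sign (partner i) * A $ partner j $ partner i * gram_sign j
          = (gram_sign i * gram_sign i) * A $ i $ j"
        using False by (simp add: gram_sign_partner mult.assoc del: gram_sign_square)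
      moreover have "A $ i $ j * gram_sign j * gram_sign j = A $ i $ j"
        by (simp add: mult.assoc)
      ultimately show ?thesis by (simp add: distrib_right)
    qed
    finally show ?thesis .
  qed
  then have "y = osp_scale 2 x"
    by (simp add: Rep_osp_inject[symmetric] vec_eq_iff osp_scale.rep_eq map_matrix_def A_def)
  then have "x = osp_scale (1/2) y" by simp
  moreover have "y \<in> osp.span (range long_root_vector)"
    unfolding y_def by (intro osp.span_sum osp.span_diff osp.span_base rangeI)
  ultimately show ?thesis by (metis osp.span_scale)
qed


lemma osp_generators:
  fixes a b :: "nat \<Rightarrow> ('n::finite) osp"
  assumes "dual_bases d a b"
  obtains gs :: "'n osp list" where "osp.span (set gs) = UNIV" "\<And>g. g \<in> set gs \<Longrightarrow> g \<in> range long_root_vector \<or> g \<in> osp_part True"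
proof -
  have "\<exists>t. finite t \<and> t \<subseteq> range long_root_vector \<and> osp_even (a i) \<in> osp.span t" for i
  proof -
    have "osp_even (a i) \<in> osp.span (range long_root_vector)"
      by (rule even_part_spanned_by_long_roots) simp
    then obtain t r where "finite t" "t \<subseteq> range long_root_vector" "osp_even (a i) = (\<Sum>x\<in>t. osp_scale (r x) x)"
      unfolding osp.span_explicit by blast
    then show ?thesis
      by (intro exI[of _ t]) (auto intro: osp.span_sum osp.span_scale osp.span_base)
  qed
  then obtain t where t: "\<And>i. finite (t i)" "\<And>i. t i \<subseteq> range long_root_vector" "\<And>i. osp_even (a i) \<in> osp.span (t i)"
    by metis
  define G where "G = (\<Union>i<d. t i) \<union> (\<lambda>i. osp_odd (a i)) ` {..<d}"
  have "finite G" using t(1) by (simp add: G_def)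
  then obtain gs where gs: "set gs = G" using finite_list by blast
  have "a i \<in> osp.span G" if "i < d" for i
  proof -
    have "osp_even (a i) \<in> osp.span G"
      using t(3)[of i] osp.span_mono[of "t i" G] that by (auto simp: G_def)
    moreover have "osp_odd (a i) \<in> osp.span G"
      using that by (intro osp.span_base) (auto simp: G_def)
    ultimately show ?thesis using osp.span_add osp_even_plus_odd by metis
  qed
  then have "osp.span (a ` {..<d}) \<subseteq> osp.span G"
    by (intro osp.span_minimal) auto
  then have "osp.span (set gs) = UNIV" using assms gs by (auto simp: dual_bases_def)
  moreover have "g \<in> range long_root_vector \<or> g \<in> osp_part True" if "g \<in> set gs" for g
    using that t(2) unfolding gs G_def by auto
  ultimately show ?thesis by (rule that)
qed

section \<open>The action of the affine Lie superalgebra\<close>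

lemma bracket_part:
  assumes "x \<in> osp_part p" "y \<in> osp_part q"
  shows "osp_bracket x y \<in> osp_part (p \<noteq> q)"
proof -
  have z: "0 ** A = 0" "A ** 0 = 0" for A :: "'a gl"
    by (simp_all add: matrix_matrix_mult_def vec_eq_iff)
  show ?thesis
    using assms
    by (cases p; cases q)
      (simp_all add: osp_part_def osp_bracket.rep_eq supercomm_def even_mat_simps odd_mat_simps
        even_mat_mult odd_mat_mult z)
qed

lemma mode_part: "x \<in> osp_part p \<Longrightarrow> mode x m \<in> affine_part p"
  by (auto simp: affine_part_def mode_def lookup_single when_def)

lemma mode_add: "mode (x + y) m = mode x m + mode y m"
  by (simp add: mode_def single_add)

lemma mode_scale: "mode (osp_scale c x) m = affine_scale c (mode x m)"
  by (simp add: mode_def affine_scale_def)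

lemma affine_bracket_modes:
  "affine_bracket (mode x m) (mode y l) =
     mode (osp_bracket x y) (m + l) + (0, if m + l = 0 then of_int m * osp_form x y else 0)"
  by (cases "x = 0"; cases "y = 0") (simp_all add: affine_bracket_def mode_def zero_prod_def)

lemma affine_bracket_central: "affine_bracket (0, c) y = 0"
  by (simp add: affine_bracket_def)

lemma sum_single: "(\<Sum>m\<in>Poly_Mapping.keys f. Poly_Mapping.single m (Poly_Mapping.lookup f m)) = f"
proof (rule poly_mapping_eqI)
  fix n
  have "Poly_Mapping.lookup (\<Sum>m\<in>Poly_Mapping.keys f. Poly_Mapping.single m (Poly_Mapping.lookup f m)) n
     = (\<Sum>m\<in>Poly_Mapping.keys f. if m = n then Poly_Mapping.lookup f m else 0)"
    by (simp add: lookup_sum lookup_single when_def)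
  also have "\<dots> = Poly_Mapping.lookup f n"
    by (simp add: in_keys_iff)
  finally show "Poly_Mapping.lookup (\<Sum>m\<in>Poly_Mapping.keys f. Poly_Mapping.single m (Poly_Mapping.lookup f m)) n
     = Poly_Mapping.lookup f n" .
qed

lemma affine_scale_central: "affine_scale c (0, 1) = (0, c)"
  by (simp add: affine_scale_def prod_eq_iff Poly_Mapping.map_eq_zero_iff)

lemma affine_decompose:
  "x = (\<Sum>m\<in>Poly_Mapping.keys (fst x). mode (Poly_Mapping.lookup (fst x) m) m) + affine_scale (snd x) (0, 1)"
proof -
  have "fst (\<Sum>m\<in>M. mode (f m) m) = (\<Sum>m\<in>M. Poly_Mapping.single m (f m))"
    "snd (\<Sum>m\<in>M. mode (f m) m) = 0" for M and f :: "int \<Rightarrow> 'a osp"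
    by (induction M rule: infinite_finite_induct) (simp_all add: mode_def)
  then show ?thesis
    by (simp add: prod_eq_iff affine_scale_def sum_single Poly_Mapping.map_eq_zero_iff)
qed

text \<open>The irreducible quotient of the vacuum module, known only through some projection from the free
  algebra. The rules for the action are read off from the relations in the kernel.\<close>

locale vacuum_module =
  fixes k :: nat and sc :: "complex \<Rightarrow> 'v::ab_group_add \<Rightarrow> 'v"
    and act :: "('n::finite) affine \<Rightarrow> 'v \<Rightarrow> 'v" and vac :: 'v
  assumes quotient: "irreducible_vacuum_quotient (of_nat k) sc act vac"
begin

sublocale vector_space sc
  using quotient by (simp add: irreducible_vacuum_quotient_def)

lemma irreducible:
  assumes "subspace S" "\<And>x v. v \<in> S \<Longrightarrow> act x v \<in> S" "v \<in> S" "v \<noteq> 0"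
  shows "S = UNIV"
  using quotient assms unfolding irreducible_vacuum_quotient_def irreducible_action_def by blast

definition proj :: "'n affine free_alg \<Rightarrow> 'v" where
  "proj = (SOME \<pi>. Vector_Spaces.linear free_scale sc \<pi> \<and> surj \<pi> \<and>
        (\<forall>r\<in>vacuum_ideal (of_nat k). \<pi> r = 0) \<and>
        (\<forall>x f. \<pi> (prepend x f) = act x (\<pi> f)) \<and>
        \<pi> (word []) = vac)"

lemma proj: "Vector_Spaces.linear free_scale sc proj" "surj proj"
    "r \<in> vacuum_ideal (of_nat k) \<Longrightarrow> proj r = 0"
    "proj (prepend x f) = act x (proj f)" "proj (word []) = vac"
proof -
  have "\<exists>\<pi>. Vector_Spaces.linear free_scale sc \<pi> \<and> surj \<pi> \<and>
        (\<forall>r\<in>vacuum_ideal (of_nat k). \<pi> r = 0) \<and>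
        (\<forall>x f. \<pi> (prepend x f) = act x (\<pi> f)) \<and> \<pi> (word []) = vac"
    using quotient by (simp add: irreducible_vacuum_quotient_def)
  from someI_ex[OF this, folded proj_def]
  show "Vector_Spaces.linear free_scale sc proj" "surj proj"
    "r \<in> vacuum_ideal (of_nat k) \<Longrightarrow> proj r = 0"
    "proj (prepend x f) = act x (proj f)" "proj (word []) = vac" by blast+
qed

lemma proj_add: "proj (f + g) = proj f + proj g"
  and proj_diff: "proj (f - g) = proj f - proj g"
  and proj_scale: "proj (free_scale c f) = sc c (proj f)"
  and proj_sum: "proj (\<Sum>i\<in>I. h i) = (\<Sum>i\<in>I. proj (h i))"
  using Vector_Spaces.linear.axioms(3)[OF proj(1)]
  by (auto simp: module_hom.add module_hom.diff module_hom.scale module_hom.sum)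

lemma proj_word_Cons: "proj (word (x # w)) = act x (proj (word w))"
proof -
  have "prepend x (word w) = word (x # w)"
    by (simp add: prepend_def word_def)
  then show ?thesis by (metis proj(4))
qed

text \<open>Linearity of the action in the vector comes from the projection: on a preimage, both sides expand over
  the words that occur in it.\<close>

lemma proj_expand:
  assumes "finite A" "Poly_Mapping.keys f \<subseteq> A"
  shows "proj f = (\<Sum>w\<in>A. sc (Poly_Mapping.lookup f w) (proj (word w)))"
    "act x (proj f) = (\<Sum>w\<in>A. sc (Poly_Mapping.lookup f w) (act x (proj (word w))))"
proof -
  have s: "Poly_Mapping.single v c = free_scale c (word v)" for v :: "'n affine list" and c
    by (simp add: free_scale_def word_def)
  have "proj f = (\<Sum>w\<in>Poly_Mapping.keys f. sc (Poly_Mapping.lookup f w) (proj (word w)))"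
    by (subst sum_single[symmetric]) (simp add: proj_sum s proj_scale)
  then show "proj f = (\<Sum>w\<in>A. sc (Poly_Mapping.lookup f w) (proj (word w)))"
    using assms by (auto simp: in_keys_iff intro!: sum.mono_neutral_left)
  have "act x (proj f) = (\<Sum>w\<in>Poly_Mapping.keys f. sc (Poly_Mapping.lookup f w) (act x (proj (word w))))"
  proof -
    have "proj (prepend x f) = (\<Sum>w\<in>Poly_Mapping.keys f. sc (Poly_Mapping.lookup f w) (proj (word (x # w))))"
      unfolding prepend_def s proj_sum proj_scale ..
    then show ?thesis by (simp only: proj(4) proj_word_Cons)
  qed
  then show "act x (proj f) = (\<Sum>w\<in>A. sc (Poly_Mapping.lookup f w) (act x (proj (word w))))"
    using assms by (auto simp: in_keys_iff intro!: sum.mono_neutral_left)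
qed

lemma act_add_right: "act x (u + v) = act x u + act x v"
proof -
  obtain f g where fg: "u = proj f" "v = proj g" using proj(2) by (metis surjD)
  define A where "A = Poly_Mapping.keys f \<union> Poly_Mapping.keys g"
  have A: "finite A" "Poly_Mapping.keys f \<subseteq> A" "Poly_Mapping.keys g \<subseteq> A" "Poly_Mapping.keys (f + g) \<subseteq> A"
    using Poly_Mapping.keys_add[of f g] by (auto simp: A_def)
  show ?thesis
    unfolding fg proj_add[symmetric] proj_expand(2)[OF A(1) A(2)] proj_expand(2)[OF A(1) A(3)]
      proj_expand(2)[OF A(1) A(4)]
    by (simp add: lookup_add scale_left_distrib sum.distrib)
qed

lemma act_scale_right: "act x (sc c v) = sc c (act x v)"
proof -
  obtain f where f: "v = proj f" using proj(2) by (metis surjD)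
  define A where "A = Poly_Mapping.keys f"
  have A: "finite A" "Poly_Mapping.keys f \<subseteq> A" "Poly_Mapping.keys (free_scale c f) \<subseteq> A"
    by (auto simp: A_def in_keys_iff)
  show ?thesis
    unfolding f proj_scale[symmetric] proj_expand(2)[OF A(1) A(2)] proj_expand(2)[OF A(1) A(3)]
    by (simp add: scale_sum_right)
qed

lemma act_zero_right [simp]: "act x 0 = 0"
  using act_scale_right[of x 0 0] by simp

lemma act_diff_right: "act x (u - v) = act x u - act x v"
  using act_add_right[of x "u - v" v] by simp

lemma act_sum_right: "act x (\<Sum>i\<in>I. f i) = (\<Sum>i\<in>I. act x (f i))"
  by (induction I rule: infinite_finite_induct) (simp_all add: act_add_right)

text \<open>Identities that are linear in the vector need to be checked on words only.\<close>

lemma word_induct: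
  assumes "subspace S" "\<And>w. proj (word w) \<in> S"
  shows "v \<in> S"
proof -
  obtain f where "v = proj f" using proj(2) by (metis surjD)
  then have "v = (\<Sum>w\<in>Poly_Mapping.keys f. sc (Poly_Mapping.lookup f w) (proj (word w)))"
    using proj_expand(1)[of "Poly_Mapping.keys f" f] by simp
  also have "\<dots> \<in> S"
    using assms by (intro subspace_sum subspace_scale) auto
  finally show ?thesis .
qed

lemma enveloping_relation: "r \<in> enveloping_ideal affine_scale affine_part affine_bracket \<Longrightarrow> proj r = 0"
  by (rule proj(3)) (auto simp: vacuum_ideal_def induced_ideal_def intro: free.span_base)

lemma act_add_left: "act (x + y) v = act x v + act y v"
proof -
  have "v \<in> {v. act (x + y) v = act x v + act y v}"
  proof (rule word_induct)
    show "subspace {v. act (x + y) v = act x v + act y v}"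
      by (auto simp: subspace_def act_add_right act_scale_right scale_right_distrib)
    fix w
    have "word ([] @ [x + y] @ w) - word ([] @ [x] @ w) - word ([] @ [y] @ w)
        \<in> enveloping_ideal affine_scale affine_part affine_bracket"
      unfolding enveloping_ideal_def by (rule free.span_base) blast
    from enveloping_relation[OF this]
    show "proj (word w) \<in> {v. act (x + y) v = act x v + act y v}"
      by (simp add: proj_diff proj_add proj_word_Cons algebra_simps)
  qed
  then show ?thesis by simp
qed

lemma act_scale_left: "act (affine_scale c x) v = sc c (act x v)"
proof -
  have "v \<in> {v. act (affine_scale c x) v = sc c (act x v)}"
  proof (rule word_induct)
    show "subspace {v. act (affine_scale c x) v = sc c (act x v)}"
      by (auto simp: subspace_def act_add_right act_scale_right scale_right_distrib)
    fix w
    have "word ([] @ [affine_scale c x] @ w) - free_scale c (word ([] @ [x] @ w))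
        \<in> enveloping_ideal affine_scale affine_part affine_bracket"
      unfolding enveloping_ideal_def by (rule free.span_base) blast
    from enveloping_relation[OF this]
    show "proj (word w) \<in> {v. act (affine_scale c x) v = sc c (act x v)}"
      by (simp add: proj_diff proj_scale proj_word_Cons)
  qed
  then show ?thesis by simp
qed

lemma act_bracket:
  assumes "x \<in> affine_part p" "y \<in> affine_part q"
  shows "act x (act y v) = sc (supersign p q) (act y (act x v)) + act (affine_bracket x y) v"
    (is "?L v = ?R v")
proof -
  have "v \<in> {v. ?L v = ?R v}"
  proof (rule word_induct)
    show "subspace {v. ?L v = ?R v}"
      by (auto simp: subspace_def act_add_right act_scale_right scale_right_distrib mult.commute)
    fix w
    have "word ([] @ [x, y] @ w) - free_scale (supersign p q) (word ([] @ [y, x] @ w))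
        - word ([] @ [affine_bracket x y] @ w) \<in> enveloping_ideal affine_scale affine_part affine_bracket"
      unfolding enveloping_ideal_def using assms by (intro free.span_base) blast
    from enveloping_relation[OF this]
    show "proj (word w) \<in> {v. ?L v = ?R v}"
      by (simp add: proj_diff proj_add proj_scale proj_word_Cons algebra_simps)
  qed
  then show ?thesis by simp
qed

lemma act_vac: "y \<in> affine_nonneg \<Longrightarrow> act y vac = sc (of_nat k * snd y) vac"
proof -
  assume y: "y \<in> affine_nonneg"
  have "word ([] @ [y]) - free_scale (of_nat k * snd y) (word []) \<in> vacuum_ideal (of_nat k)"
    unfolding vacuum_ideal_def induced_ideal_def using y
    by (intro free.span_base UnI2) blast
  from proj(3)[OF this] show ?thesis
    by (simp add: proj_diff proj_scale proj_word_Cons proj(5))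
qed

lemma act_zero_left [simp]: "act 0 v = 0"
  using act_add_left[of 0 0 v] by simp

lemma act_sum_left: "act (\<Sum>i\<in>I. f i) v = (\<Sum>i\<in>I. act (f i) v)"
  by (induction I rule: infinite_finite_induct) (simp_all add: act_add_left)

lemma mode_vac: "m \<ge> 0 \<Longrightarrow> act (mode x m) vac = 0"
  using act_vac[of "mode x m"]
  by (auto simp: affine_nonneg_def mode_def lookup_single when_def)

text \<open>Every element of the affine algebra is a sum of homogeneous modes and a multiple of \<open>K\<close>.\<close>

lemma act_invariant:
  assumes "subspace S" "\<And>x p m v. x \<in> osp_part p \<Longrightarrow> v \<in> S \<Longrightarrow> act (mode x m) v \<in> S"
    and "\<And>v. v \<in> S \<Longrightarrow> act (0, 1) v \<in> S" and "v \<in> S"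
  shows "act x v \<in> S"
proof -
  have m: "act (mode y m) v \<in> S" for y m
  proof -
    have "act (mode y m) v = act (mode (osp_even y) m) v + act (mode (osp_odd y) m) v"
      by (simp add: osp_even_plus_odd flip: act_add_left mode_add)
    also have "\<dots> \<in> S"
      using assms(2)[OF osp_part_even assms(4)] assms(2)[OF osp_part_odd assms(4)]
      by (intro subspace_add[OF assms(1)])
    finally show ?thesis .
  qed
  show ?thesis
    by (subst affine_decompose, unfold act_add_left act_sum_left act_scale_left)
      (intro subspace_add[OF assms(1)] subspace_sum[OF assms(1)] subspace_scale[OF assms(1)] m assms)
qed

lemma vac_nonzero: "vac \<noteq> 0"
proof
  assume "vac = 0"
  have "v \<in> {0}" for v :: 'v
  proof (rule word_induct)
    fix w
    have "proj (word w) = 0"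
    proof (induction w)
      case Nil
      show ?case using proj(5) \<open>vac = 0\<close> by (rule trans)
    qed (simp only: proj_word_Cons act_zero_right)
    then show "proj (word w) \<in> {0}" by simp
  qed (rule subspace_single_0)
  then show False
    using quotient by (auto simp: irreducible_vacuum_quotient_def irreducible_action_def)
qed

text \<open>The vectors on which \<open>K\<close> acts by \<open>k\<close> form a submodule that contains the vacuum.\<close>

lemma central_charge: "act (0, c) v = sc (of_nat k * c) v"
proof -
  let ?S = "{v. act (0, 1) v = sc (of_nat k) v}"
  have sub: "subspace ?S"
    by (auto simp: subspace_def act_add_right act_scale_right scale_right_distrib mult.commute)
  have even: "(0, 1) \<in> affine_part False" by (simp add: affine_part_def)
  have "?S = UNIV"
  proof (rule irreducible[OF sub _ _ vac_nonzero])
    show "vac \<in> ?S" using act_vac[of "(0, 1)"] by (simp add: affine_nonneg_def)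
    show "act x v \<in> ?S" if "v \<in> ?S" for x v
    proof (rule act_invariant[OF sub _ _ that])
      fix y :: "'n osp" and p m u assume y: "y \<in> osp_part p" and u: "u \<in> ?S"
      show "act (mode y m) u \<in> ?S"
        using act_bracket[OF even mode_part[OF y], of m u] u
        by (simp add: affine_bracket_central supersign_def act_scale_right)
    qed (simp add: act_scale_right)
  qed
  then have "act (0, 1) v = sc (of_nat k) v" by auto
  moreover have "act (0, c) v = act (affine_scale c (0, 1)) v"
    by (simp only: affine_scale_central)
  ultimately show ?thesis by (simp add: act_scale_left mult.commute)
qed

lemma mode_add_left: "act (mode (x + y) m) v = act (mode x m) v + act (mode y m) v"
  by (simp add: mode_add act_add_left)

lemma mode_scale_left: "act (mode (osp_scale c x) m) v = sc c (act (mode x m) v)"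
  by (simp add: mode_scale act_scale_left)

lemma mode_zero_left [simp]: "act (mode 0 m) v = 0"
  using mode_add_left[of 0 0 m v] by simp

lemma mode_uminus_left: "act (mode (- x) m) v = - act (mode x m) v"
  using mode_add_left[of x "- x" m v] by (simp add: minus_unique)

lemma mode_sum_left: "act (mode (\<Sum>i\<in>I. f i) m) v = (\<Sum>i\<in>I. act (mode (f i) m) v)"
  by (induction I rule: infinite_finite_induct) (simp_all add: mode_add_left)

text \<open>The second element is arbitrary: its odd component picks up the sign through \<open>osp_twist\<close>.\<close>

lemma mode_commute:
  assumes "x \<in> osp_part p"
  shows "act (mode x m) (act (mode a l) v) = act (mode (osp_twist p a) l) (act (mode x m) v)
     + act (mode (osp_bracket x a) (m + l)) v
     + (if m + l = 0 then sc (of_int m * of_nat k * osp_form x a) v else 0)"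
proof -
  have hom: "act (mode x m) (act (mode a l) v) = act (mode (osp_twist p a) l) (act (mode x m) v)
     + act (mode (osp_bracket x a) (m + l)) v
     + (if m + l = 0 then sc (of_int m * of_nat k * osp_form x a) v else 0)"
    if "a \<in> osp_part q" for a q
    using act_bracket[OF mode_part[OF assms] mode_part[OF that], of m l v]
    by (simp add: affine_bracket_modes act_add_left central_charge osp_twist_part[OF that]
        mode_scale_left mult_ac)
  obtain a0 a1 where a: "a = a0 + a1" "a0 \<in> osp_part False" "a1 \<in> osp_part True"
    by (metis osp_even_plus_odd osp_part_even osp_part_odd)
  show ?thesis
    using hom[OF a(2)] hom[OF a(3)]
    by (simp add: a(1) mode_add_left osp_twist_add bracket_add form_add act_add_right algebra_simps
        scale_left_distrib)
qed

lemma mode_commute_even: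
  assumes "a \<in> osp_part False"
  shows "act (mode x m) (act (mode a l) v) = act (mode a l) (act (mode x m) v)
     + act (mode (osp_bracket x a) (m + l)) v
     + (if m + l = 0 then sc (of_int m * of_nat k * osp_form x a) v else 0)"
proof -
  have tw: "osp_twist p a = a" for p
    by (simp add: osp_twist_part[OF assms] supersign_def)
  obtain x0 x1 where x: "x = x0 + x1" "x0 \<in> osp_part False" "x1 \<in> osp_part True"
    by (metis osp_even_plus_odd osp_part_even osp_part_odd)
  show ?thesis
    using mode_commute[OF x(2), of m a l v] mode_commute[OF x(3), of m a l v]
    by (simp add: x(1) tw mode_add_left bracket_add form_add act_add_right algebra_simps
        scale_left_distrib)
qed

text \<open>This is the part of the Poincare-Birkhoff-Witt theorem that is needed: a vector killed by
  the modes of index at least \<open>c\<close> generates the module under the modes of smaller index, since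
  a mode of index at least \<open>c\<close> can be commuted to the right of a word until it meets the vector.\<close>

lemma generated_by_lower_modes:
  assumes "subspace S" "u \<in> S" "u \<noteq> 0"
    and lower: "\<And>x p m v. x \<in> osp_part p \<Longrightarrow> m < c \<Longrightarrow> v \<in> S \<Longrightarrow> act (mode x m) v \<in> S"
    and kill: "\<And>x p m. x \<in> osp_part p \<Longrightarrow> m \<ge> c \<Longrightarrow> act (mode x m) u = 0"
  shows "S = UNIV"
proof -
  define ok where "ok = (\<lambda>ws :: ('n osp \<times> int) list. \<forall>(x, m)\<in>set ws. m < c \<and> (\<exists>p. x \<in> osp_part p))"
  define wd where "wd = (\<lambda>ws. foldr (\<lambda>(x, m). act (mode x m)) ws u)"
  define T where "T = span (wd ` Collect ok)"
  have sub: "subspace T" by (simp add: T_def)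
  have low: "act (mode x m) v \<in> T" if x: "x \<in> osp_part p" "m < c" and v: "v \<in> T" for x p m v
    using v unfolding T_def
  proof (induction rule: span_induct_alt)
    case (step r v w)
    then obtain ws where "v = wd ws" "ok ws" by auto
    then have "act (mode x m) v = wd ((x, m) # ws)" "ok ((x, m) # ws)"
      using x by (auto simp: wd_def ok_def)
    then have "act (mode x m) v \<in> span (wd ` Collect ok)"
      by (metis image_eqI mem_Collect_eq span_base)
    then show ?case
      using step by (simp add: act_add_right act_scale_right span_add span_scale)
  qed (simp add: span_zero)
  have word: "act (mode x m) (wd ws) \<in> T" if "ok ws" "x \<in> osp_part p" for ws x p m
    using that
  proof (induction ws arbitrary: x p m)
    case Nil
    have "wd [] \<in> T" unfolding T_def by (rule span_base) (simp add: ok_def)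
    then show ?case
      using low[of x p m u] kill[of x p m] Nil(2) subspace_0[OF sub]
      by (cases "m < c") (simp_all add: wd_def)
  next
    case (Cons y ws)
    obtain a l where y: "y = (a, l)" by force
    obtain q where a: "a \<in> osp_part q" "l < c" and ok: "ok ws"
      using Cons.prems(1) by (auto simp: y ok_def)
    have "wd ws \<in> T" using ok by (auto simp: T_def intro: span_base)
    moreover have "wd (y # ws) = act (mode a l) (wd ws)" by (simp add: wd_def y)
    moreover have "act (mode (osp_twist p a) l) (act (mode x m) (wd ws)) \<in> T"
      using low[OF a Cons.IH[OF ok Cons.prems(2)]] sub
      by (simp add: osp_twist_part[OF a(1)] mode_scale_left subspace_scale)
    moreover have "act (mode (osp_bracket x a) (m + l)) (wd ws) \<in> T"
      by (rule Cons.IH[OF ok bracket_part[OF Cons.prems(2) a(1)]])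
    ultimately show ?case
      using sub by (auto simp: mode_commute[OF Cons.prems(2)] intro!: subspace_add subspace_scale)
  qed
  have all: "act (mode x m) v \<in> T" if x: "x \<in> osp_part p" and v: "v \<in> T" for x p m v
    using v unfolding T_def
  proof (induction rule: span_induct_alt)
    case (step r v w)
    then show ?case
      using word[OF _ x, of _ m] by (auto simp: act_add_right act_scale_right T_def intro!: span_add span_scale)
  qed (simp add: span_zero)
  have "T = UNIV"
  proof (rule irreducible[OF sub _ _ \<open>u \<noteq> 0\<close>])
    have "u = wd []" "ok []" by (simp_all add: wd_def ok_def)
    then show "u \<in> T" unfolding T_def by (metis image_eqI mem_Collect_eq span_base)
    show "act x v \<in> T" if "v \<in> T" for x v
      by (rule act_invariant[OF sub all _ that])
        (auto simp: central_charge intro: subspace_scale[OF sub])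
  qed
  moreover have "wd ws \<in> S" if "ok ws" for ws
    using that by (induction ws) (auto simp: wd_def ok_def \<open>u \<in> S\<close> intro: lower)
  then have "T \<subseteq> S" unfolding T_def by (intro span_minimal \<open>subspace S\<close>) auto
  ultimately show ?thesis by auto
qed

end


section \<open>The conformal weights\<close>

text \<open>The tensor \<open>\<Sum>\<^sub>i a\<^sub>i \<otimes> b\<^sub>i\<close> represents the identity map, so an operator on the first factor may be moved to
  the second as its adjoint. The bilinear map \<open>G\<close> stands in for the tensor product.\<close>

lemma casimir_adjoint:
  fixes G :: "('n::finite) osp \<Rightarrow> 'n osp \<Rightarrow> 'v::ab_group_add"
  assumes dual: "dual_bases d a b"
    and left: "\<And>c x y. G (\<Sum>i<d. osp_scale (c i) (x i)) y = (\<Sum>i<d. sc (c i) (G (x i) y))"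
    and right: "\<And>c x y. G x (\<Sum>i<d. osp_scale (c i) (y i)) = (\<Sum>i<d. sc (c i) (G x (y i)))"
    and adjoint: "\<And>x y. osp_form y (f x) = osp_form (g y) x"
  shows "(\<Sum>i<d. G (f (a i)) (b i)) = (\<Sum>i<d. G (a i) (g (b i)))"
proof -
  have "(\<Sum>i<d. G (f (a i)) (b i)) = (\<Sum>i<d. \<Sum>j<d. sc (osp_form (g (b j)) (a i)) (G (a j) (b i)))"
  proof (intro sum.cong refl)
    fix i
    have "f (a i) = (\<Sum>j<d. osp_scale (osp_form (g (b j)) (a i)) (a j))"
      using dual_bases_expand_left[OF dual, of "f (a i)"] by (simp add: adjoint)
    then have "G (f (a i)) (b i) = G (\<Sum>j<d. osp_scale (osp_form (g (b j)) (a i)) (a j)) (b i)"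
      by (rule arg_cong)
    then show "G (f (a i)) (b i) = (\<Sum>j<d. sc (osp_form (g (b j)) (a i)) (G (a j) (b i)))"
      by (simp only: left)
  qed
  also have "\<dots> = (\<Sum>j<d. \<Sum>i<d. sc (osp_form (g (b j)) (a i)) (G (a j) (b i)))"
    by (rule sum.swap)
  also have "\<dots> = (\<Sum>j<d. G (a j) (g (b j)))"
  proof (intro sum.cong refl)
    fix j
    have "G (a j) (g (b j)) = G (a j) (\<Sum>i<d. osp_scale (osp_form (g (b j)) (a i)) (b i))"
      by (rule arg_cong[OF dual_bases_expand_right[OF dual, of "g (b j)"]])
    then show "(\<Sum>i<d. sc (osp_form (g (b j)) (a i)) (G (a j) (b i))) = G (a j) (g (b j))"
      by (simp only: right)
  qed
  finally show ?thesis .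
qed

locale affine_vosa =
  vacuum_module k sc act vac +
  vertex_operator_superalgebra sc "module_part sc act vac" Y vac \<omega>
  for k :: nat and sc :: "complex \<Rightarrow> 'v::ab_group_add \<Rightarrow> 'v"
    and act :: "('n::finite) affine \<Rightarrow> 'v \<Rightarrow> 'v" and vac :: 'v
    and Y :: "'v \<Rightarrow> int \<Rightarrow> 'v \<Rightarrow> 'v" and \<omega> :: 'v +
  fixes d :: nat and a b :: "nat \<Rightarrow> 'n osp"
  assumes level_pos: "k \<ge> 1"
    and dual: "dual_bases d a b"
    and conformal: "\<omega> = sugawara_vector (of_nat k) sc act vac d a b"
    and field: "\<And>x m v. Y (act (mode x (-1)) vac) m v = act (mode x m) v"
begin

lemma Y_scale_left: "Y (sc c u) m w = sc c (Y u m w)"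
  by (rule module_hom.scale[OF Vector_Spaces.linear.axioms(3)[OF Y_linear_left]])

lemma Y_zero_left [simp]: "Y 0 m w = 0"
  by (rule module_hom.zero[OF Vector_Spaces.linear.axioms(3)[OF Y_linear_left]])

lemma Y_add_left: "Y (u + v) m w = Y u m w + Y v m w"
  by (rule module_hom.add[OF Vector_Spaces.linear.axioms(3)[OF Y_linear_left]])

lemma Y_scale_right: "Y u m (sc c w) = sc c (Y u m w)"
  by (rule module_hom.scale[OF Vector_Spaces.linear.axioms(3)[OF Y_linear_right]])

lemma Y_add_right: "Y u m (v + w) = Y u m v + Y u m w"
  by (rule module_hom.add[OF Vector_Spaces.linear.axioms(3)[OF Y_linear_right]])

lemma mode_vac_part: "x \<in> osp_part p \<Longrightarrow> act (mode x m) vac \<in> module_part sc act vac p"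
  using homogeneous_word.intros(2)[OF mode_part homogeneous_word.intros(1), of x p m]
  by (force simp: module_part_def intro!: span_base exI[of _ "[mode x m]"])

text \<open>The case \<open>l = 0\<close> of the Borcherds identity, in which the right-hand side is the supercommutator.\<close>

lemma Y_commutator:
  assumes u: "u \<in> module_part sc act vac p" and v: "v \<in> module_part sc act vac q"
    and N: "\<And>i. i \<ge> N \<Longrightarrow> Y u (int i) v = 0"
  shows "Y u m (Y v n w) = sc (supersign p q) (Y v n (Y u m w)) +
    (\<Sum>i<N. sc (of_int m gchoose i) (Y (Y u (int i) v) (m + n - int i) w))"
proof -
  have "Sum_any (\<lambda>i::nat. sc (of_int m gchoose i) (Y (Y u (0 + int i) v) (m + n - int i) w)) =
      Sum_any (\<lambda>i::nat. sc ((-1) ^ i * (of_int 0 gchoose i))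
        (Y u (m + 0 - int i) (Y v (n + int i) w)
          - sc (supersign p q * (-1) powi 0) (Y v (n + 0 - int i) (Y u (m + int i) w))))"
    by (rule Borcherds[OF u v])
  also have "\<dots> = Y u m (Y v n w) - sc (supersign p q) (Y v n (Y u m w))"
  proof -
    have "(0 :: complex) gchoose i = 0" if "i \<noteq> 0" for i
      using that by (cases i) auto
    then show ?thesis
      by (subst Sum_any.expand_superset[of "{0}"]) auto
  qed
  also have "Sum_any (\<lambda>i::nat. sc (of_int m gchoose i) (Y (Y u (0 + int i) v) (m + n - int i) w))
      = (\<Sum>i<N. sc (of_int m gchoose i) (Y (Y u (int i) v) (m + n - int i) w))"
    by (subst Sum_any.expand_superset[of "{..<N}"]) (auto simp: N intro: leI, metis N leI Y_zero_left scale_zero_right)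
  finally show ?thesis by (simp add: algebra_simps)
qed

lemma mode_mode_vac:
  assumes "j \<ge> 0"
  shows "act (mode y j) (act (mode x (-1)) vac) = act (mode (osp_bracket y x) (j - 1)) vac
    + (if j = 1 then sc (of_nat k * osp_form y x) vac else 0)"
proof -
  obtain y0 y1 where y: "y = y0 + y1" "y0 \<in> osp_part False" "y1 \<in> osp_part True"
    by (metis osp_even_plus_odd osp_part_even osp_part_odd)
  show ?thesis
    using mode_commute[OF y(2), of j x "-1" vac] mode_commute[OF y(3), of j x "-1" vac] assms
    by (simp add: y(1) mode_vac mode_add_left bracket_add form_add scale_left_distrib algebra_simps)
qed

text \<open>The Sugawara vector is a multiple of \<open>\<Sum>\<^sub>i quadratic (a\<^sub>i) (b\<^sub>i)\<close>.\<close>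

abbreviation quadratic :: "'n osp \<Rightarrow> 'n osp \<Rightarrow> 'v" where
  "quadratic x y \<equiv> act (mode x (-1)) (act (mode y (-1)) vac)"

lemma mode_quadratic:
  assumes "x \<in> osp_part p" "j \<ge> 0"
  shows "act (mode x j) (quadratic y z) =
     act (mode (osp_twist p y) (-1)) (act (mode x j) (act (mode z (-1)) vac))
     + act (mode (osp_bracket x y) (j - 1)) (act (mode z (-1)) vac)
     + (if j = 1 then sc (of_nat k * osp_form x y) (act (mode z (-1)) vac) else 0)"
  using mode_commute[OF assms(1), of j y "-1"] assms(2) by simp

text \<open>The two terms \<open>[x,a\<^sub>i] \<otimes> b\<^sub>i\<close> and \<open>\<plusminus> a\<^sub>i \<otimes> [x,b\<^sub>i]\<close> cancel: by invariance of the form the adjoint of \<open>[x,-]\<close>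
  is \<open>[-,x]\<close>, which by skew supersymmetry is \<open>[x,-]\<close> up to a sign and a twist, and the twist is its own
  adjoint.\<close>

lemma casimir_zero_mode:
  assumes x: "x \<in> osp_part p"
  shows "act (mode x 0) (\<Sum>i<d. quadratic (a i) (b i)) = 0"
proof -
  have "act (mode x 0) (\<Sum>i<d. quadratic (a i) (b i)) =
     (\<Sum>i<d. quadratic (osp_bracket x (a i)) (b i)) + (\<Sum>i<d. quadratic (osp_twist p (a i)) (osp_bracket x (b i)))"
    by (simp add: act_sum_right mode_quadratic[OF x] mode_mode_vac sum.distrib add.commute)
  also have "(\<Sum>i<d. quadratic (osp_bracket x (a i)) (b i)) = (\<Sum>i<d. quadratic (a i) (osp_bracket (b i) x))"
    by (rule casimir_adjoint[OF dual, of _ sc])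
      (simp_all add: mode_sum_left mode_scale_left act_sum_right act_scale_right form_invariant[OF x])
  also have "\<dots> = - (\<Sum>i<d. quadratic (a i) (osp_bracket x (osp_twist p (b i))))"
    using act_diff_right[of _ 0]
    by (simp add: bracket_skew[OF x] mode_uminus_left sum_negf)
  also have "(\<Sum>i<d. quadratic (a i) (osp_bracket x (osp_twist p (b i)))) =
      (\<Sum>i<d. quadratic (osp_twist p (a i)) (osp_bracket x (b i)))"
  proof (rule casimir_adjoint[OF dual, of "\<lambda>y z. quadratic y (osp_bracket x z)" sc "osp_twist p" "osp_twist p", symmetric])
    have *: "osp_bracket x (\<Sum>i\<in>I. f i) = (\<Sum>i\<in>I. osp_bracket x (f i))" for I :: "nat set" and f
      by (induction I rule: infinite_finite_induct) (simp_all add: bracket_add)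
    show "quadratic y (osp_bracket x (\<Sum>i<d. osp_scale (c i) (z i))) =
      (\<Sum>i<d. sc (c i) (quadratic y (osp_bracket x (z i))))" for c y z
      by (simp add: * bracket_scale mode_sum_left mode_scale_left act_sum_right act_scale_right)
    show "osp_form y (osp_twist p z) = osp_form (osp_twist p y) z" for y z
      using form_twist[of p y "osp_twist p z"] by (simp only: osp_twist_twist)
  qed (simp add: mode_sum_left mode_scale_left)
  finally show ?thesis by simp
qed

lemma omega_eq: obtains c where "\<omega> = sc c (\<Sum>i<d. quadratic (a i) (b i))"
  using that conformal unfolding sugawara_vector_def by blast

text \<open>Up to the normalization of \<open>\<omega>\<close>, the element \<open>z\<close> is \<open>2 k x\<close> plus the Casimir operator applied to \<open>x\<close>.
  It is left unevaluated, as the derivative property of \<open>L(-1)\<close> determines it later.\<close>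

lemma mode_omega:
  assumes x: "x \<in> osp_part p"
  shows "act (mode x 0) \<omega> = 0"
    "\<exists>z. act (mode x 1) \<omega> = act (mode z (-1)) vac"
    "\<exists>c. act (mode x 2) \<omega> = sc c vac"
    "j \<ge> 3 \<Longrightarrow> act (mode x j) \<omega> = 0"
proof -
  obtain r where w: "\<omega> = sc r (\<Sum>i<d. quadratic (a i) (b i))" by (rule omega_eq)
  show "act (mode x 0) \<omega> = 0"
    by (simp add: w act_scale_right casimir_zero_mode[OF x])
  define z where "z = (\<lambda>i. osp_bracket (osp_bracket x (a i)) (b i)
      + osp_scale (of_nat k * osp_form x (a i)) (b i)
      + osp_scale (of_nat k * osp_form x (b i)) (osp_twist p (a i)))"
  have "act (mode x 1) (quadratic (a i) (b i)) = act (mode (z i) (-1)) vac" for i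
    by (simp add: mode_quadratic[OF x] mode_mode_vac z_def mode_add_left mode_scale_left mode_vac
        act_scale_right algebra_simps)
  then have "act (mode x 1) \<omega> = act (mode (osp_scale r (\<Sum>i<d. z i)) (-1)) vac"
    by (simp add: w act_scale_right act_sum_right mode_scale_left mode_sum_left)
  then show "\<exists>z. act (mode x 1) \<omega> = act (mode z (-1)) vac" by blast
  have "act (mode x 2) (quadratic (a i) (b i)) = sc (of_nat k * osp_form (osp_bracket x (a i)) (b i)) vac" for i
    by (simp add: mode_quadratic[OF x] mode_mode_vac mode_vac)
  then have "act (mode x 2) \<omega> = sc (r * (\<Sum>i<d. of_nat k * osp_form (osp_bracket x (a i)) (b i))) vac"
    by (simp only: w act_scale_right act_sum_right scale_sum_left scale_scale[symmetric])
  then show "\<exists>c. act (mode x 2) \<omega> = sc c vac" by blast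
  show "act (mode x j) \<omega> = 0" if "j \<ge> 3"
    using that by (simp add: w act_scale_right act_sum_right mode_quadratic[OF x] mode_mode_vac mode_vac)
qed

lemma mode_omega_mode:
  assumes x: "x \<in> osp_part p"
  obtains z c where "\<And>m n w. act (mode x m) (Y \<omega> n w) = Y \<omega> n (act (mode x m) w)
      + sc (of_int m) (act (mode z (m + n - 1)) w)
      + sc ((of_int m gchoose 2) * c) (if m + n = 1 then w else 0)"
proof -
  obtain z where z: "act (mode x 1) \<omega> = act (mode z (-1)) vac" using mode_omega(2)[OF x] ..
  obtain c where c: "act (mode x 2) \<omega> = sc c vac" using mode_omega(3)[OF x] ..
  have "act (mode x m) (Y \<omega> n w) = Y \<omega> n (act (mode x m) w)
      + sc (of_int m) (act (mode z (m + n - 1)) w)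
      + sc ((of_int m gchoose 2) * c) (if m + n = 1 then w else 0)" for m n w
  proof -
    have "act (mode x m) (Y \<omega> n w) = Y \<omega> n (act (mode x m) w) +
      (\<Sum>i<3. sc (of_int m gchoose i) (Y (act (mode x (int i)) \<omega>) (m + n - int i) w))"
      using Y_commutator[OF mode_vac_part[OF x, of "-1"] conformal_even, of 3 m n w] mode_omega(4)[OF x]
      by (simp add: field supersign_def)
    also have "\<dots> = Y \<omega> n (act (mode x m) w) + sc (of_int m) (act (mode z (m + n - 1)) w)
        + sc ((of_int m gchoose 2) * c) (if m + n = 1 then w else 0)"
      by (simp add: numeral_3_eq_3 mode_omega(1)[OF x] z field c[unfolded numeral_2_eq_2, simplified]
          Y_scale_left vac_field numeral_2_eq_2)
    finally show ?thesis .
  qed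
  then show ?thesis by (rule that)
qed

text \<open>This restates the \<open>L(-1)\<close>-derivative property as a commutator with the translation operator \<open>\<omega>\<^sub>0\<close>.\<close>

lemma translation_mode:
  assumes x: "x \<in> osp_part p"
  shows "Y \<omega> 0 (act (mode x n) w) = act (mode x n) (Y \<omega> 0 w) - sc (of_int n) (act (mode x (n - 1)) w)"
proof -
  let ?v = "act (mode x (-1)) vac"
  obtain M where M: "\<And>m. m \<ge> M \<Longrightarrow> Y \<omega> m ?v = 0" using truncation[of \<omega> ?v] by blast
  have "Y \<omega> 0 (Y ?v n w) = sc (supersign False p) (Y ?v n (Y \<omega> 0 w)) +
      (\<Sum>i<Suc (nat M). sc (of_int 0 gchoose i) (Y (Y \<omega> (int i) ?v) (0 + n - int i) w))"
    by (rule Y_commutator[OF conformal_even mode_vac_part[OF x]]) (rule M, linarith)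
  also have "(\<Sum>i<Suc (nat M). sc (of_int 0 gchoose i) (Y (Y \<omega> (int i) ?v) (0 + n - int i) w))
      = Y (Y \<omega> 0 ?v) n w"
  proof -
    have "(0 :: complex) gchoose Suc i = 0" for i by simp
    then show ?thesis by (simp add: sum.lessThan_Suc_shift del: sum.lessThan_Suc)
  qed
  finally show ?thesis
    by (simp add: supersign_def L_neg_one_derivative field)
qed

text \<open>Both \<open>m z(m-1)\<close> and \<open>m x(m-1)\<close> express the commutator of \<open>x(m)\<close> with \<open>\<omega>\<^sub>0\<close>. At \<open>m = 2\<close> this says
  \<open>z(1) = x(1)\<close>; applied to \<open>y(-1) vac\<close> it becomes \<open>k (z|y) = k (x|y)\<close>, and \<open>k \<noteq> 0\<close>.\<close>

lemma weight_mode: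
  assumes x: "x \<in> osp_part p"
  shows "Y \<omega> 1 (act (mode x m) w) = act (mode x m) (Y \<omega> 1 w) - sc (of_int m) (act (mode x m) w)"
proof -
  obtain z c where zc: "\<And>m n w. act (mode x m) (Y \<omega> n w) = Y \<omega> n (act (mode x m) w)
      + sc (of_int m) (act (mode z (m + n - 1)) w)
      + sc ((of_int m gchoose 2) * c) (if m + n = 1 then w else 0)"
    by (rule mode_omega_mode[OF x]) blast
  have 1: "act (mode z 1) w = act (mode x 1) w" for w
    using zc[of 2 0 w] translation_mode[OF x, of 2 w] by (simp add: algebra_simps)
  have "osp_form (z - x) y = 0" for y
    using 1[of "act (mode y (-1)) vac"] level_pos vac_nonzero
    by (simp add: mode_mode_vac mode_vac form_minus)
  then have "z - x = 0" by (rule form_nondegenerate[OF dual])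
  then have "z = x" by simp
  \<comment> \<open>The multiple of the vacuum could only contribute for \<open>m = 0\<close>, where its coefficient vanishes.\<close>
  moreover have "(0 :: complex) gchoose 2 = 0" by (simp add: numeral_2_eq_2)
  ultimately show ?thesis using zc[of m 1 w] by (auto simp: algebra_simps)
qed

end


section \<open>Vanishing of powers of long root vectors\<close>

context affine_vosa
begin

text \<open>The operator \<open>(L(0) - n) \<dots> (L(0) - 1)\<close>. For large \<open>n\<close> it kills a given sum of vectors of positive integral
  weights, but it never kills the vacuum.\<close>

primrec weight_product :: "nat \<Rightarrow> 'v \<Rightarrow> 'v" where
  "weight_product 0 v = v"
| "weight_product (Suc n) v = Y \<omega> 1 (weight_product n v) - sc (of_nat (Suc n)) (weight_product n v)"

lemma weight_product_linear:
  "weight_product n (u + v) = weight_product n u + weight_product n v"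
  "weight_product n (sc c v) = sc c (weight_product n v)"
  by (induction n) (simp_all add: Y_add_right Y_scale_right scale_right_distrib scale_right_diff_distrib
      mult.commute)

lemma weight_product_eigenvector:
  assumes "Y \<omega> 1 v = sc r v"
  shows "weight_product n v = sc (\<Prod>i=1..n. r - of_nat i) v"
proof (induction n)
  case (Suc n)
  then show ?case
    by (simp add: Y_scale_right assms flip: scale_left_diff_distrib) (simp add: algebra_simps)
qed simp

lemma vac_not_in_positive_weights:
  "vac \<notin> span {v. \<exists>r\<ge>1. Y \<omega> 1 v = sc (of_nat r) v}"
proof
  let ?S = "{v. \<exists>n. \<forall>m\<ge>n. weight_product m v = 0}"
  assume "vac \<in> span {v. \<exists>r\<ge>1. Y \<omega> 1 v = sc (of_nat r) v}"
  moreover have "span {v. \<exists>r\<ge>1. Y \<omega> 1 v = sc (of_nat r) v} \<subseteq> ?S"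
  proof (rule span_minimal)
    show "subspace ?S"
    proof (rule subspaceI)
      show "0 \<in> ?S" using weight_product_linear(2)[of _ 0] by simp
      show "sc c v \<in> ?S" if "v \<in> ?S" for c v
        using that by (auto simp: weight_product_linear)
      show "u + v \<in> ?S" if "u \<in> ?S" "v \<in> ?S" for u v
      proof -
        from that obtain n n' where "\<forall>m\<ge>n. weight_product m u = 0" "\<forall>m\<ge>n'. weight_product m v = 0"
          by blast
        then have "\<forall>m\<ge>max n n'. weight_product m (u + v) = 0"
          by (simp add: weight_product_linear)
        then show ?thesis by blast
      qed
    qed
    show "{v. \<exists>r\<ge>1. Y \<omega> 1 v = sc (of_nat r) v} \<subseteq> ?S"
    proof
      fix v assume "v \<in> {v. \<exists>r\<ge>1. Y \<omega> 1 v = sc (of_nat r) v}"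
      then obtain r :: nat where r: "r \<ge> 1" "Y \<omega> 1 v = sc (of_nat r) v" by blast
      have "weight_product m v = 0" if "m \<ge> r" for m
      proof -
        have "(\<Prod>i=1..m. of_nat r - of_nat i :: complex) = 0"
          using r(1) that by (intro prod_zero) (auto intro!: bexI[of _ r])
        then show ?thesis by (simp add: weight_product_eigenvector[OF r(2)])
      qed
      then show "v \<in> ?S" by blast
    qed
  qed
  ultimately obtain n where "weight_product n vac = 0" by blast
  moreover have "weight_product n vac = sc (\<Prod>i=1..n. 0 - of_nat i) vac"
    by (rule weight_product_eigenvector) (simp add: creation)
  ultimately show False using vac_nonzero by simp
qed

text \<open>By \<open>[[x,e],e] = -2 (x|e) e\<close>, each factor \<open>e(-1)\<close> is an eigenvector of bracketing with \<open>[x,e](0)\<close>.\<close>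

lemma long_root_power_zero_mode:
  fixes v
  defines "e \<equiv> long_root_vector v"
  shows "act (mode (osp_bracket x e) 0) ((act (mode e (-1)) ^^ j) vac) =
    sc (- 2 * of_nat j * osp_form x e) ((act (mode e (-1)) ^^ j) vac)"
proof (induction j)
  case 0
  show ?case by (simp add: mode_vac)
next
  case (Suc j)
  have "act (mode (osp_bracket x e) 0) (act (mode e (-1)) u) = act (mode e (-1)) (act (mode (osp_bracket x e) 0) u)
      + sc (- 2 * osp_form x e) (act (mode e (-1)) u)" for u
    unfolding e_def by (subst mode_commute_even[OF long_root_vector_even])
      (simp add: long_root_double_bracket mode_scale_left mode_uminus_left)
  then show ?case
    by (simp only: funpow.simps o_apply Suc act_scale_right flip: scale_left_distrib)
      (simp add: algebra_simps)
qed

text \<open>Moving \<open>x(1)\<close> past one more factor \<open>e(-1)\<close> adds \<open>[x,e](0) + k (x|e)\<close>, which acts on the remaining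
  power \<open>e(-1)^j vac\<close> by \<open>(k - 2 j) (x|e)\<close>. Summing these contributions gives the coefficient.\<close>

lemma long_root_power_mode_one:
  fixes v
  defines "e \<equiv> long_root_vector v"
  shows "act (mode x 1) ((act (mode e (-1)) ^^ Suc j) vac) =
    sc (osp_form x e * of_nat (Suc j) * (of_nat k - of_nat j)) ((act (mode e (-1)) ^^ j) vac)"
proof -
  have comm: "act (mode x 1) (act (mode e (-1)) u) = act (mode e (-1)) (act (mode x 1) u)
      + act (mode (osp_bracket x e) 0) u + sc (of_nat k * osp_form x e) u" for x u
    unfolding e_def by (subst mode_commute_even[OF long_root_vector_even]) simp
  note zero = long_root_power_zero_mode[of x v, folded e_def]
  show ?thesis
  proof (induction j)
    case 0
    show ?case by (simp add: comm mode_vac mult.commute)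
  next
    case (Suc j)
    define N where "N = (act (mode e (-1)) ^^ j) vac"
    have "act (mode x 1) (act (mode e (-1)) (act (mode e (-1)) N)) =
        sc (osp_form x e * of_nat (Suc j) * (of_nat k - of_nat j)) (act (mode e (-1)) N)
        + sc (- 2 * of_nat (Suc j) * osp_form x e) (act (mode e (-1)) N)
        + sc (of_nat k * osp_form x e) (act (mode e (-1)) N)"
    proof -
      have "act (mode x 1) (act (mode e (-1)) N) = sc (osp_form x e * of_nat (Suc j) * (of_nat k - of_nat j)) N"
        using Suc by (simp add: N_def)
      moreover have "act (mode (osp_bracket x e) 0) (act (mode e (-1)) N) =
          sc (- 2 * of_nat (Suc j) * osp_form x e) (act (mode e (-1)) N)"
        using zero[of "Suc j"] by (simp add: N_def)
      ultimately show ?thesis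
        using comm[of x "act (mode e (-1)) N"] by (simp only: act_scale_right)
    qed
    then have "act (mode x 1) (act (mode e (-1)) (act (mode e (-1)) N)) =
        sc (osp_form x e * of_nat (Suc (Suc j)) * (of_nat k - of_nat (Suc j))) (act (mode e (-1)) N)"
      by (simp only: scale_left_distrib[symmetric]) (simp add: algebra_simps)
    then show ?case by (simp add: N_def)
  qed
qed

text \<open>The commutator with \<open>e(-1)\<close> is \<open>[x,e](m-1)\<close>. For \<open>m = 2\<close> it is governed by the previous formula, whose
  coefficient \<open>([x,e]|e) = (x|[e,e])\<close> is zero.\<close>

lemma long_root_power_mode_ge_2:
  fixes v
  defines "e \<equiv> long_root_vector v"
  assumes "m \<ge> 2"
  shows "act (mode x m) ((act (mode e (-1)) ^^ j) vac) = 0"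
  using \<open>m \<ge> 2\<close>
proof (induction j arbitrary: x m)
  case 0
  then show ?case by (simp add: mode_vac)
next
  case (Suc j)
  let ?N = "(act (mode e (-1)) ^^ j) vac"
  have "osp_form (osp_bracket x e) e = 0"
    by (simp add: e_def form_invariant[OF long_root_vector_even] long_root_bracket_self)
  then have "act (mode (osp_bracket x e) 1) ?N = 0"
    using long_root_power_mode_one[of "osp_bracket x e" _ v, folded e_def] by (cases j) (simp_all add: mode_vac)
  then have "act (mode (osp_bracket x e) (m - 1)) ?N = 0"
    using Suc.IH[of "m - 1" "osp_bracket x e"] Suc.prems by (cases "m = 2") simp_all
  then show ?case
    using mode_commute_even[OF long_root_vector_even, of x m v "-1" ?N, folded e_def] Suc by simp
qed

lemma long_root_power_weight:
  "Y \<omega> 1 ((act (mode (long_root_vector v) (-1)) ^^ j) vac) =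
     sc (of_nat j) ((act (mode (long_root_vector v) (-1)) ^^ j) vac)"
proof (induction j)
  case 0
  show ?case by (simp add: creation)
next
  case (Suc j)
  then show ?case
    by (simp add: weight_mode[OF long_root_vector_even] act_scale_right scale_left_distrib)
qed

text \<open>Otherwise the singular vector would generate the module by modes that do not lower the weight, and
  the vacuum would be a sum of vectors of positive weight.\<close>

lemma long_root_power_vanishes:
  "(act (mode (long_root_vector v) (-1)) ^^ Suc k) vac = 0"
proof (rule ccontr)
  let ?w = "(act (mode (long_root_vector v) (-1)) ^^ Suc k) vac"
  let ?E = "{v. \<exists>r\<ge>1. Y \<omega> 1 v = sc (of_nat r) v}"
  assume "?w \<noteq> 0"
  have "span ?E = UNIV"
  proof (rule generated_by_lower_modes[OF subspace_span _ \<open>?w \<noteq> 0\<close>, of ?E 1])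
    show "?w \<in> span ?E"
      by (rule span_base) (use long_root_power_weight[of "Suc k" v] in \<open>auto intro: exI[of _ "Suc k"]\<close>)
    show "act (mode x m) ?w = 0" if "m \<ge> 1" for x :: "'n osp" and m
    proof (cases "m = 1")
      case True
      then show ?thesis using long_root_power_mode_one[of x k v] by simp
    next
      case False
      then show ?thesis using that by (intro long_root_power_mode_ge_2) simp
    qed
    fix x :: "'n osp" and p m u assume x: "x \<in> osp_part p" and m: "m < (1 :: int)" and u: "u \<in> span ?E"
    show "act (mode x m) u \<in> span ?E"
      using u
    proof (induction rule: span_induct_alt)
      case (step c u w)
      then obtain r :: nat where r: "r \<ge> 1" "Y \<omega> 1 u = sc (of_nat r) u" by blast
      have "Y \<omega> 1 (act (mode x m) u) = sc (of_nat (r + nat (- m))) (act (mode x m) u)"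
        using m by (simp add: weight_mode[OF x] r(2) act_scale_right flip: scale_left_diff_distrib)
      then have "act (mode x m) u \<in> ?E" using r(1) by (intro CollectI exI[of _ "r + nat (- m)"]) simp
      then show ?case
        using step(2) by (simp add: act_add_right act_scale_right span_add span_scale span_base)
    qed (simp add: span_zero)
  qed
  then show False using vac_not_in_positive_weights by simp
qed

end

section \<open>Operators that are nilpotent modulo a subspace\<close>

text \<open>The set \<open>B\<close> consists of the ordered monomials \<open>T\<^sub>1^n\<^sub>1 \<dots> T\<^sub>r^n\<^sub>r u\<close> with all \<open>n\<^sub>i \<le> k\<close>. Operators are added at the
  left end: the new one raises its exponent or lands in \<open>C\<close>, and an old one commutes past the powers of
  the new one up to a scalar, modulo \<open>C\<close>.\<close>

lemma (in vector_space) finite_span_of_nilpotent_operators: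
  fixes Ts :: "('b \<Rightarrow> 'b) list"
  assumes C: "subspace C"
    and linear: "\<And>T v w. T \<in> set Ts \<Longrightarrow> T (v + w) = T v + T w"
      "\<And>T c v. T \<in> set Ts \<Longrightarrow> T (scale c v) = scale c (T v)"
    and stable: "\<And>T v. T \<in> set Ts \<Longrightarrow> v \<in> C \<Longrightarrow> T v \<in> C"
    and commute: "\<And>S T. S \<in> set Ts \<Longrightarrow> T \<in> set Ts \<Longrightarrow> \<exists>c. \<forall>v. S (T v) - scale c (T (S v)) \<in> C"
    and nilpotent: "\<And>T v. T \<in> set Ts \<Longrightarrow> (T ^^ Suc k) v \<in> C"
  shows "\<exists>B. finite B \<and> u \<in> B \<and> (\<forall>T\<in>set Ts. \<forall>v\<in>span (B \<union> C). T v \<in> span (B \<union> C))"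
  using linear stable commute nilpotent
proof (induction Ts)
  case Nil
  show ?case by (rule exI[of _ "{u}"]) simp
next
  case (Cons T Ts)
  have "\<exists>B. finite B \<and> u \<in> B \<and> (\<forall>T\<in>set Ts. \<forall>v\<in>span (B \<union> C). T v \<in> span (B \<union> C))"
    by (rule Cons.IH) (use Cons.prems in auto)
  then obtain B where B: "finite B" "u \<in> B"
    "\<And>S v. S \<in> set Ts \<Longrightarrow> v \<in> span (B \<union> C) \<Longrightarrow> S v \<in> span (B \<union> C)"
    by blast
  have invariant: "S v \<in> span X"
    if S: "S \<in> set (T # Ts)" and X: "\<And>x. x \<in> X \<Longrightarrow> S x \<in> span X" and v: "v \<in> span X" for S X v
    using v
  proof (induction rule: span_induct_alt)
    case base
    have "S 0 = 0" using Cons.prems(2)[OF S, of 0 0] by simp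
    then show ?case by (simp add: span_zero)
  next
    case (step c x w)
    then show ?case
      using Cons.prems(1,2)[OF S] X by (simp add: span_add span_scale)
  qed
  define B' where "B' = (\<Union>n\<le>k. (T ^^ n) ` B)"
  define X where "X = B' \<union> C"
  have B': "finite B'" "B \<subseteq> B'"
    using B(1) by (auto simp: B'_def intro!: bexI[of _ 0])
  have T: "T v \<in> span X" if "v \<in> span X" for v
  proof (rule invariant[OF _ _ that])
    fix x assume "x \<in> X"
    then consider "x \<in> C" | n b where "n \<le> k" "b \<in> B" "x = (T ^^ n) b"
      by (auto simp: X_def B'_def)
    then show "T x \<in> span X"
    proof cases
      case 1
      then have "T x \<in> C" using Cons.prems(3)[of T x] by simp
      then show ?thesis by (intro span_base) (simp add: X_def)
    next
      case 2
      then have Tx: "T x = (T ^^ Suc n) b" by simp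
      show ?thesis
      proof (cases "n = k")
        case True
        then have "T x \<in> C" using Cons.prems(5)[of T b] Tx by simp
        then show ?thesis by (intro span_base) (simp add: X_def)
      next
        case False
        then have "T x \<in> B'" using Tx 2 unfolding B'_def by (intro UN_I[of "Suc n"]) auto
        then show ?thesis by (intro span_base) (simp add: X_def)
      qed
    qed
  qed simp
  have sub: "span (B \<union> C) \<subseteq> span X"
    using B' by (intro span_mono) (auto simp: X_def)
  have pow: "(T ^^ n) v \<in> span X" if "v \<in> span (B \<union> C)" for n v
    using that sub T by (induction n) auto
  have S: "S v \<in> span X" if S: "S \<in> set Ts" and v: "v \<in> span X" for S v
  proof (rule invariant[OF _ _ v])
    obtain c where c: "\<And>v. S (T v) - scale c (T (S v)) \<in> C"
      using Cons.prems(4)[of S T] S by auto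
    \<comment> \<open>The scalar \<open>c\<close> of a single exchange is independent of the vector, so \<open>n\<close> exchanges produce \<open>c^n\<close>.\<close>
    have "\<exists>c. S ((T ^^ n) v) - scale c ((T ^^ n) (S v)) \<in> C" for n v
    proof (induction n)
      case 0
      show ?case using subspace_0[OF C] by (intro exI[of _ 1]) simp
    next
      case (Suc n)
      then obtain c' where c': "S ((T ^^ n) v) - scale c' ((T ^^ n) (S v)) \<in> C" by blast
      let ?r = "S ((T ^^ n) v) - scale c' ((T ^^ n) (S v))"
      have "T (S ((T ^^ n) v)) = T (?r + scale c' ((T ^^ n) (S v)))" by simp
      also have "\<dots> = T ?r + scale c' ((T ^^ Suc n) (S v))"
        by (subst Cons.prems(1)) (simp_all add: Cons.prems(2))
      finally have "S ((T ^^ Suc n) v) - scale (c * c') ((T ^^ Suc n) (S v)) =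
          (S (T ((T ^^ n) v)) - scale c (T (S ((T ^^ n) v)))) + scale c (T ?r)"
        by (simp add: scale_right_distrib)
      also have "\<dots> \<in> C"
        using Cons.prems(3)[of T ?r] c' by (intro subspace_add subspace_scale C c) auto
      finally show ?case by blast
    qed note twisted = this
    fix x assume "x \<in> X"
    then consider "x \<in> C" | n b where "b \<in> B" "x = (T ^^ n) b"
      by (auto simp: X_def B'_def)
    then show "S x \<in> span X"
    proof cases
      case 1
      then have "S x \<in> C" using S Cons.prems(3)[of S x] by simp
      then show ?thesis by (intro span_base) (simp add: X_def)
    next
      case 2
      obtain c' where c': "S x - scale c' ((T ^^ n) (S b)) \<in> C" using twisted[of n b] 2 by auto
      have "S b \<in> span (B \<union> C)" using 2 by (intro B(3)[OF S, of b] span_base) simp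
      then have "scale c' ((T ^^ n) (S b)) \<in> span X" by (intro span_scale pow)
      moreover have "S x - scale c' ((T ^^ n) (S b)) \<in> span X"
        using c' by (intro span_base) (simp add: X_def)
      ultimately show ?thesis using span_add by fastforce
    qed
  qed (use S in simp)
  show ?case
    using B' B(2) T S by (intro exI[of _ B']) (auto simp: X_def)
qed

section \<open>The quotient by C2\<close>

context affine_vosa
begin

abbreviation C2 :: "'v set" where
  "C2 \<equiv> C2_subspace sc Y"

lemma subspace_C2: "subspace C2"
  by (simp add: C2_subspace_def)

text \<open>The derivative property turns \<open>u\<^sub>m\<^sub>-\<^sub>1\<close> into a multiple of \<open>(L(-1) u)\<^sub>m\<close>, so all lower products reduce to
  the product with index \<open>-2\<close>.\<close>

lemma C2_lower: "Y u (- 2 - int n) v \<in> C2"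
proof (induction n arbitrary: u)
  case 0
  show ?case unfolding C2_subspace_def by (rule span_base) auto
next
  case (Suc n)
  define m where "m = - 2 - int n"
  have "Y (Y \<omega> 0 u) m v \<in> C2" unfolding m_def by (rule Suc)
  then have "sc (- 1 / of_int m) (Y (Y \<omega> 0 u) m v) \<in> C2" by (rule subspace_scale[OF subspace_C2])
  moreover have "m \<noteq> 0" by (simp add: m_def)
  ultimately have "Y u (m - 1) v \<in> C2" by (simp add: L_neg_one_derivative)
  then show ?case by (simp add: m_def algebra_simps)
qed

lemma mode_le_2_C2: "m \<le> -2 \<Longrightarrow> act (mode x m) v \<in> C2"
  using C2_lower[of "act (mode x (-1)) vac" "nat (- 2 - m)" v] by (simp add: field)

text \<open>In the commutator of \<open>x(-1)\<close> with \<open>u\<^sub>-\<^sub>2\<close> every term has index at most \<open>-3\<close>.\<close>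

lemma mode_C2:
  assumes x: "x \<in> osp_part p" and v: "v \<in> C2"
  shows "act (mode x (-1)) v \<in> C2"
proof -
  have hom: "act (mode x (-1)) (Y u (-2) w) \<in> C2" if u: "u \<in> module_part sc act vac q" for u w q
  proof -
    let ?x = "act (mode x (-1)) vac"
    obtain M where M: "\<And>m. m \<ge> M \<Longrightarrow> Y ?x m u = 0" using truncation[of ?x u] by blast
    have "Y ?x (-1) (Y u (-2) w) = sc (supersign p q) (Y u (-2) (Y ?x (-1) w)) +
      (\<Sum>i<nat M. sc (of_int (-1) gchoose i) (Y (Y ?x (int i) u) (-1 + -2 - int i) w))"
      by (rule Y_commutator[OF mode_vac_part[OF x] u]) (rule M, linarith)
    moreover have "Y u (-2) (Y ?x (-1) w) \<in> C2"
      using C2_lower[of u 0] by simp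
    moreover have "Y (Y ?x (int i) u) (-1 + -2 - int i) w \<in> C2" for i
    proof -
      have "-1 + -2 - int i = - 2 - int (Suc i)" by simp
      then show ?thesis using C2_lower[of "Y ?x (int i) u" "Suc i" w] by metis
    qed
    ultimately show ?thesis
      by (simp only: field) (intro subspace_add subspace_sum subspace_scale subspace_C2)
  qed
  have "act (mode x (-1)) (Y u (-2) w) \<in> C2" for u w
  proof -
    obtain u0 u1 where "u0 \<in> module_part sc act vac False" "u1 \<in> module_part sc act vac True" "u = u0 + u1"
      using part_sum[of u] by blast
    then show ?thesis
      using hom by (auto simp: Y_add_left act_add_right intro: subspace_add[OF subspace_C2])
  qed
  then have "C2 \<subseteq> {v. act (mode x (-1)) v \<in> C2}"
    by (subst (1) C2_subspace_def, intro span_minimal subspaceI)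
      (auto simp: act_add_right act_scale_right
        intro: subspace_add[OF subspace_C2] subspace_scale[OF subspace_C2] subspace_0[OF subspace_C2])
  then show ?thesis using v by blast
qed

text \<open>The supercommutator is \<open>[x,y](-2)\<close>.\<close>

lemma modes_supercommute_mod_C2:
  assumes "x \<in> osp_part p" "y \<in> osp_part q"
  shows "act (mode x (-1)) (act (mode y (-1)) v) - sc (supersign p q) (act (mode y (-1)) (act (mode x (-1)) v)) \<in> C2"
  using mode_commute[OF assms(1), of "-1" y "-1" v] mode_le_2_C2[of "-2" "osp_bracket x y" v]
  by (simp add: osp_twist_part[OF assms(2)] mode_scale_left)

lemma odd_square_C2:
  assumes "x \<in> osp_part True"
  shows "act (mode x (-1)) (act (mode x (-1)) v) \<in> C2"
proof -
  let ?w = "act (mode x (-1)) (act (mode x (-1)) v)"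
  have "?w + ?w \<in> C2"
    using modes_supercommute_mod_C2[OF assms assms, of v] by (simp add: supersign_def)
  then have "sc (1/2) (?w + ?w) \<in> C2" by (rule subspace_scale[OF subspace_C2])
  moreover have "sc (1/2) (?w + ?w) = ?w"
    by (simp add: scale_right_distrib flip: scale_left_distrib)
  ultimately show ?thesis by simp
qed

text \<open>As \<open>e(-1)\<close> commutes with all \<open>x(-1)\<close> modulo \<open>C2\<close>, its power can be moved to the right of any
  monomial, where it meets the vacuum and vanishes.\<close>

lemma long_root_power_C2:
  "(act (mode (long_root_vector u) (-1)) ^^ Suc k) v \<in> C2"
proof -
  let ?E = "act (mode (long_root_vector u) (-1))"
  have lin: "(?E ^^ j) (v + w) = (?E ^^ j) v + (?E ^^ j) w" "(?E ^^ j) (sc c v) = sc c ((?E ^^ j) v)" for j v w c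
    by (induction j) (simp_all add: act_add_right act_scale_right)
  have stable: "(?E ^^ j) w \<in> C2" if "w \<in> C2" for j w
    using that by (induction j) (simp_all add: mode_C2[OF long_root_vector_even])
  have "{v. (?E ^^ Suc k) v \<in> C2} = UNIV"
  proof (rule generated_by_lower_modes[OF _ _ vac_nonzero, of _ 0])
    show "subspace {v. (?E ^^ Suc k) v \<in> C2}"
    proof (rule subspaceI)
      show "0 \<in> {v. (?E ^^ Suc k) v \<in> C2}" using stable[OF subspace_0[OF subspace_C2], of "Suc k"] by blast
    qed (auto simp only: mem_Collect_eq lin intro!: subspace_add[OF subspace_C2] subspace_scale[OF subspace_C2])
    show "vac \<in> {v. (?E ^^ Suc k) v \<in> C2}"
      using long_root_power_vanishes[of u] subspace_0[OF subspace_C2] by (simp only: mem_Collect_eq)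
    show "act (mode x m) vac = 0" if "m \<ge> 0" for x :: "'n osp" and m
      using that by (rule mode_vac)
    fix x :: "'n osp" and p m v assume x: "x \<in> osp_part p" and m: "m < (0 :: int)" and v: "v \<in> {v. (?E ^^ Suc k) v \<in> C2}"
    show "act (mode x m) v \<in> {v. (?E ^^ Suc k) v \<in> C2}"
    proof (cases "m = -1")
      case True
      have "(?E ^^ j) (act (mode x (-1)) v) - act (mode x (-1)) ((?E ^^ j) v) \<in> C2" for j
      proof (induction j)
        case 0
        show ?case using subspace_0[OF subspace_C2] by simp
      next
        case (Suc j)
        have "?E ((?E ^^ j) (act (mode x (-1)) v) - act (mode x (-1)) ((?E ^^ j) v)) +
          (?E (act (mode x (-1)) ((?E ^^ j) v)) - act (mode x (-1)) (?E ((?E ^^ j) v))) \<in> C2"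
          using modes_supercommute_mod_C2[OF long_root_vector_even x, of u "(?E ^^ j) v"]
          by (intro subspace_add[OF subspace_C2] mode_C2[OF long_root_vector_even Suc])
            (simp add: supersign_def)
        then show ?case by (simp add: act_diff_right)
      qed
      moreover have "act (mode x (-1)) ((?E ^^ Suc k) v) \<in> C2"
        using v by (intro mode_C2[OF x]) simp
      ultimately have "((?E ^^ Suc k) (act (mode x (-1)) v) - act (mode x (-1)) ((?E ^^ Suc k) v))
          + act (mode x (-1)) ((?E ^^ Suc k) v) \<in> C2"
        by (intro subspace_add[OF subspace_C2])
      then show ?thesis using True by (simp del: funpow.simps)
    next
      case False
      then show ?thesis using m by (intro CollectI stable mode_le_2_C2) simp
    qed
  qed
  then show ?thesis by blast
qed

text \<open>The span of \<open>C2\<close> and the bounded monomials contains the vacuum and is stable under all negative modes: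
  under \<open>x(-1)\<close> by the monomial argument, under the lower ones because these map into \<open>C2\<close>.\<close>

lemma finite_codimension_C2: "C2_cofinite sc Y"
proof -
  obtain gs :: "'n osp list" where gs: "osp.span (set gs) = UNIV"
    "\<And>g. g \<in> set gs \<Longrightarrow> g \<in> range long_root_vector \<or> g \<in> osp_part True"
    by (rule osp_generators[OF dual]) blast
  define Ts where "Ts = map (\<lambda>g. act (mode g (-1))) gs"
  have hom: "\<exists>p. g \<in> osp_part p" if "g \<in> set gs" for g
    using gs(2)[OF that] long_root_vector_even by blast
  have "\<exists>B. finite B \<and> vac \<in> B \<and> (\<forall>T\<in>set Ts. \<forall>v\<in>span (B \<union> C2). T v \<in> span (B \<union> C2))"
  proof (rule finite_span_of_nilpotent_operators[OF subspace_C2])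
    show "T (v + w) = T v + T w" "T (sc c v) = sc c (T v)" if "T \<in> set Ts" for T v w c
      using that by (auto simp: Ts_def act_add_right act_scale_right)
    show "T v \<in> C2" if "T \<in> set Ts" "v \<in> C2" for T v
      using that hom mode_C2 by (fastforce simp: Ts_def)
    show "\<exists>c. \<forall>v. S (T v) - sc c (T (S v)) \<in> C2" if "S \<in> set Ts" "T \<in> set Ts" for S T
    proof -
      from that obtain g h where gh: "g \<in> set gs" "S = act (mode g (-1))" "h \<in> set gs" "T = act (mode h (-1))"
        by (auto simp: Ts_def)
      obtain p q where "g \<in> osp_part p" "h \<in> osp_part q" using hom gh by blast
      from modes_supercommute_mod_C2[OF this] show ?thesis unfolding gh by blast
    qed
    show "(T ^^ Suc k) v \<in> C2" if "T \<in> set Ts" for T v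
    proof -
      from that obtain g where g: "g \<in> set gs" "T = act (mode g (-1))" by (auto simp: Ts_def)
      show ?thesis
      proof (cases "g \<in> range long_root_vector")
        case True
        then show ?thesis using long_root_power_C2 g(2) by auto
      next
        case False
        then have "g \<in> osp_part True" using gs(2)[OF g(1)] by blast
        moreover obtain j where "k = Suc j" using level_pos by (cases k) auto
        ultimately show ?thesis using odd_square_C2[of g] by (simp add: g(2))
      qed
    qed
  qed
  then obtain B where B: "finite B" "vac \<in> B" "\<And>T v. T \<in> set Ts \<Longrightarrow> v \<in> span (B \<union> C2) \<Longrightarrow> T v \<in> span (B \<union> C2)"
    by blast
  let ?X = "span (B \<union> C2)"
  have minus_one: "act (mode x (-1)) v \<in> ?X" if "v \<in> ?X" for x v
  proof -
    have "osp.span (set gs) \<subseteq> {x. act (mode x (-1)) v \<in> ?X}"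
      using B(3)[OF _ that]
      by (intro osp.span_minimal osp.subspaceI)
        (auto simp: Ts_def mode_add_left mode_scale_left span_zero span_add span_scale)
    then show ?thesis using gs(1) by auto
  qed
  have "?X = UNIV"
  proof (rule generated_by_lower_modes[OF subspace_span _ vac_nonzero, of _ 0])
    show "vac \<in> ?X" using B(2) by (simp add: span_base)
    show "act (mode x m) vac = 0" if "m \<ge> 0" for x :: "'n osp" and m
      using that by (rule mode_vac)
    show "act (mode x m) v \<in> ?X" if "m < 0" "v \<in> ?X" for x :: "'n osp" and m v
    proof (cases "m = -1")
      case True
      then show ?thesis using minus_one[OF that(2)] by simp
    next
      case False
      then have "act (mode x m) v \<in> C2" using that(1) by (intro mode_le_2_C2) simp
      then show ?thesis by (simp add: span_base)
    qed
  qed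
  have "\<exists>b\<in>span B. v - b \<in> C2" for v
  proof -
    have "v \<in> ?X" using \<open>?X = UNIV\<close> by simp
    then obtain b c where "b \<in> span B" "c \<in> span C2" "v = b + c"
      unfolding span_Un by blast
    moreover have "span C2 = C2" using subspace_C2 by (simp add: span_eq_iff)
    ultimately show ?thesis by (intro bexI[of _ b]) auto
  qed
  then show ?thesis unfolding C2_cofinite_def using B(1) by blast
qed

end

theorem theorem5p5:
  fixes k :: nat
    and sc :: "complex \<Rightarrow> 'v::ab_group_add \<Rightarrow> 'v"
    and act :: "('n::finite) affine \<Rightarrow> 'v \<Rightarrow> 'v"
    and vac \<omega> :: 'v
    and Y :: "'v \<Rightarrow> int \<Rightarrow> 'v \<Rightarrow> 'v"
    and d :: nat and a b :: "nat \<Rightarrow> 'n osp"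
  assumes "k \<ge> 1"
    and "irreducible_vacuum_quotient (of_nat k) sc act vac"
    and "dual_bases d a b"
    and "\<omega> = sugawara_vector (of_nat k) sc act vac d a b"
    and "vertex_operator_superalgebra sc (module_part sc act vac) Y vac \<omega>"
    and "\<And>x m v. Y (act (mode x (-1)) vac) m v = act (mode x m) v"
  shows "C2_cofinite sc Y"
proof -
  interpret affine_vosa k sc act vac Y \<omega> d a b
    using assms by (intro affine_vosa.intro vacuum_module.intro affine_vosa_axioms.intro)
  show ?thesis by (rule finite_codimension_C2)
qed

end
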